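(* Let $\mathcal{C}=\{(\mathbf{p}_i,\mathbf{q}_i)\}_{i=1}^M$ with $\mathbf{p}_i,\mathbf{q}_i\in\mathbb{R}^3$, let $\epsilon>0$, and let $\mathbf{t}\in\mathbb{R}^3$. There is a deterministic algorithm that, given $\mathcal{C}$, $\epsilon$ and $\mathbf{t}$, computes in $\mathcal{O}(M\log M)$ time the value $$U(\mathbf{t}\mid\mathcal{C},\epsilon)=\max_{\theta\in[0,2\pi]}\sum_{i=1}^M\mathbb{I}\left(\|\mathbf{R}(\theta)\mathbf{p}_i+\mathbf{t}-\mathbf{q}_i\|\le\epsilon\right)$$ together with an angle $\tilde{\theta}$ attaining the maximum.
   Context: For $\theta\in[0,2\pi]$, $\mathbf{R}(\theta)=\begin{pmatrix}\cos\theta&\sin\theta&0\\-\sin\theta&\cos\theta&0\\0&0&1\end{pmatrix}$ is the rotation about the third axis; $\mathbb{I}$ is 1 if its argument is true and 0 otherwise; $\|\cdot\|$ is the Euclidean norm. Running time counts arithmetic operations, comparisons, square roots and (inverse) trigonometric evaluations on real numbers as unit cost. *)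

theory Defs
  imports "HOL-Analysis.Analysis" "HOL-Library.Landau_Symbols"
begin

definition rot :: "real \<Rightarrow> real^3^3" where
  "rot \<theta> = vector [vector [cos \<theta>, sin \<theta>, 0],
                   vector [- sin \<theta>, cos \<theta>, 0],
                   vector [0, 0, 1]]"

text \<open>The correspondences form an indexed family (repetitions count separately), hence a list.\<close>

definition votes :: "((real^3) \<times> (real^3)) list \<Rightarrow> real \<Rightarrow> real^3 \<Rightarrow> real \<Rightarrow> nat" where
  "votes C \<epsilon> t \<theta> =
    (\<Sum>i<length C. of_bool (norm (rot \<theta> *v fst (C ! i) + t - snd (C ! i)) \<le> \<epsilon>))"

definition max_votes :: "((real^3) \<times> (real^3)) list \<Rightarrow> real \<Rightarrow> real^3 \<Rightarrow> nat" where
  "max_votes C \<epsilon> t = Max (votes C \<epsilon> t ` {0..2*pi})"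

lemma votes_le: "votes C \<epsilon> t \<theta> \<le> length C"
proof -
  have "votes C \<epsilon> t \<theta> \<le> (\<Sum>i<length C. 1)"
    unfolding votes_def by (rule sum_mono) simp
  then show ?thesis by simp
qed

lemma max_votes_is_maximum:
  "max_votes C \<epsilon> t \<in> votes C \<epsilon> t ` {0..2*pi}"
  "\<theta> \<in> {0..2*pi} \<Longrightarrow> votes C \<epsilon> t \<theta> \<le> max_votes C \<epsilon> t"
proof -
  have "votes C \<epsilon> t ` {0..2*pi} \<subseteq> {..length C}"
    using votes_le by blast
  then have fin: "finite (votes C \<epsilon> t ` {0..2*pi})"
    using finite_subset by blast
  show "max_votes C \<epsilon> t \<in> votes C \<epsilon> t ` {0..2*pi}"
    unfolding max_votes_def using fin by (intro Max_in) auto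
  show "votes C \<epsilon> t \<theta> \<le> max_votes C \<epsilon> t" if "\<theta> \<in> {0..2*pi}"
    unfolding max_votes_def using fin that by (intro Max_ge) auto
qed

text \<open>
  Algorithms are programs of a real RAM, given as a structured imperative language. The
  machine has registers and random-access arrays holding exact reals, and registers and arrays
  holding natural numbers for counting and addressing. Every arithmetic operation, comparison,
  square root, (inverse) trigonometric evaluation, constant, memory access and control step
  costs one unit.

  To keep unit cost honest, programs contain only integer real constants (so that no
  information can be hidden in a constant), there is no conversion from reals to naturals
  (in particular no rounding), and naturals have no unit-cost multiplication.
\<close>

type_synonym name = string

record state =
  nvar :: "name \<Rightarrow> nat"
  narr :: "name \<Rightarrow> nat \<Rightarrow> nat"
  rvar :: "name \<Rightarrow> real"
  rarr :: "name \<Rightarrow> nat \<Rightarrow> real"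

datatype nexp =
    NConst nat
  | NVar name
  | NArr name nexp
  | NAdd nexp nexp
  | NSub nexp nexp

datatype rexp =
    RConst int
  | RVar name
  | RArr name nexp
  | RAdd rexp rexp
  | RSub rexp rexp
  | RMul rexp rexp
  | RDiv rexp rexp
  | RSqrt rexp
  | RSin rexp
  | RCos rexp
  | RTan rexp
  | RArcsin rexp
  | RArccos rexp
  | RArctan rexp

datatype bexp =
    NLess nexp nexp
  | RLess rexp rexp
  | BNot bexp
  | BAnd bexp bexp

datatype com =
    SKIP
  | NAssign name nexp
  | NStore name nexp nexp
  | RAssign name rexp
  | RStore name nexp rexp
  | SEQ com com
  | IF bexp com com
  | WHILE bexp com

text \<open>Subtraction of naturals is truncated.\<close>

fun nval :: "nexp \<Rightarrow> state \<Rightarrow> nat" where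
  "nval (NConst k) s = k"
| "nval (NVar x) s = nvar s x"
| "nval (NArr a e) s = narr s a (nval e s)"
| "nval (NAdd e f) s = nval e s + nval f s"
| "nval (NSub e f) s = nval e s - nval f s"

text \<open>
  Operations are total, as in HOL. This gives no extra power: x / 0 and tan at a pole are 0,
  sqrt is odd, and arcsin and arccos outside [-1, 1] are unspecified, so a program could
  test for these cases by a comparison instead.
\<close>

fun rval :: "rexp \<Rightarrow> state \<Rightarrow> real" where
  "rval (RConst k) s = of_int k"
| "rval (RVar x) s = rvar s x"
| "rval (RArr a e) s = rarr s a (nval e s)"
| "rval (RAdd e f) s = rval e s + rval f s"
| "rval (RSub e f) s = rval e s - rval f s"
| "rval (RMul e f) s = rval e s * rval f s"
| "rval (RDiv e f) s = rval e s / rval f s"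
| "rval (RSqrt e) s = sqrt (rval e s)"
| "rval (RSin e) s = sin (rval e s)"
| "rval (RCos e) s = cos (rval e s)"
| "rval (RTan e) s = tan (rval e s)"
| "rval (RArcsin e) s = arcsin (rval e s)"
| "rval (RArccos e) s = arccos (rval e s)"
| "rval (RArctan e) s = arctan (rval e s)"

fun bval :: "bexp \<Rightarrow> state \<Rightarrow> bool" where
  "bval (NLess e f) s \<longleftrightarrow> nval e s < nval f s"
| "bval (RLess e f) s \<longleftrightarrow> rval e s < rval f s"
| "bval (BNot b) s \<longleftrightarrow> \<not> bval b s"
| "bval (BAnd b c) s \<longleftrightarrow> bval b s \<and> bval c s"

fun ncost :: "nexp \<Rightarrow> nat" where
  "ncost (NConst k) = 1"
| "ncost (NVar x) = 1"
| "ncost (NArr a e) = 1 + ncost e"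
| "ncost (NAdd e f) = 1 + ncost e + ncost f"
| "ncost (NSub e f) = 1 + ncost e + ncost f"

fun rcost :: "rexp \<Rightarrow> nat" where
  "rcost (RConst k) = 1"
| "rcost (RVar x) = 1"
| "rcost (RArr a e) = 1 + ncost e"
| "rcost (RAdd e f) = 1 + rcost e + rcost f"
| "rcost (RSub e f) = 1 + rcost e + rcost f"
| "rcost (RMul e f) = 1 + rcost e + rcost f"
| "rcost (RDiv e f) = 1 + rcost e + rcost f"
| "rcost (RSqrt e) = 1 + rcost e"
| "rcost (RSin e) = 1 + rcost e"
| "rcost (RCos e) = 1 + rcost e"
| "rcost (RTan e) = 1 + rcost e"
| "rcost (RArcsin e) = 1 + rcost e"
| "rcost (RArccos e) = 1 + rcost e"
| "rcost (RArctan e) = 1 + rcost e"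

fun bcost :: "bexp \<Rightarrow> nat" where
  "bcost (NLess e f) = 1 + ncost e + ncost f"
| "bcost (RLess e f) = 1 + rcost e + rcost f"
| "bcost (BNot b) = 1 + bcost b"
| "bcost (BAnd b c) = 1 + bcost b + bcost c"

text \<open>\<open>exec c s n s'\<close>: started in \<open>s\<close>, the program \<open>c\<close> halts in \<open>s'\<close> after \<open>n\<close> units of time.\<close>

inductive exec :: "com \<Rightarrow> state \<Rightarrow> nat \<Rightarrow> state \<Rightarrow> bool" where
  Skip: "exec SKIP s 1 s"
| NAssign: "exec (NAssign x e) s (1 + ncost e) (s\<lparr>nvar := (nvar s)(x := nval e s)\<rparr>)"
| NStore: "exec (NStore a i e) s (1 + ncost i + ncost e)
    (s\<lparr>narr := (narr s)(a := (narr s a)(nval i s := nval e s))\<rparr>)"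
| RAssign: "exec (RAssign x e) s (1 + rcost e) (s\<lparr>rvar := (rvar s)(x := rval e s)\<rparr>)"
| RStore: "exec (RStore a i e) s (1 + ncost i + rcost e)
    (s\<lparr>rarr := (rarr s)(a := (rarr s a)(nval i s := rval e s))\<rparr>)"
| Seq: "exec c s m s' \<Longrightarrow> exec d s' n s'' \<Longrightarrow> exec (SEQ c d) s (m + n) s''"
| IfTrue: "bval b s \<Longrightarrow> exec c s n s' \<Longrightarrow> exec (IF b c d) s (1 + bcost b + n) s'"
| IfFalse: "\<not> bval b s \<Longrightarrow> exec d s n s' \<Longrightarrow> exec (IF b c d) s (1 + bcost b + n) s'"
| WhileFalse: "\<not> bval b s \<Longrightarrow> exec (WHILE b c) s (1 + bcost b) s"
| WhileTrue: "bval b s \<Longrightarrow> exec c s m s' \<Longrightarrow> exec (WHILE b c) s' n s'' \<Longrightarrow>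
    exec (WHILE b c) s (1 + bcost b + m + n) s''"

inductive_cases exec_SkipE: "exec SKIP s n s'"
inductive_cases exec_NAssignE: "exec (NAssign x e) s n s'"
inductive_cases exec_NStoreE: "exec (NStore a i e) s n s'"
inductive_cases exec_RAssignE: "exec (RAssign x e) s n s'"
inductive_cases exec_RStoreE: "exec (RStore a i e) s n s'"
inductive_cases exec_SeqE: "exec (SEQ c d) s n s'"
inductive_cases exec_IfE: "exec (IF b c d) s n s'"
inductive_cases exec_WhileE: "exec (WHILE b c) s n s'"

lemma exec_deterministic:
  "exec c s n s' \<Longrightarrow> exec c s n' s'' \<Longrightarrow> n' = n \<and> s'' = s'"
proof (induction arbitrary: n' s'' rule: exec.induct)
  case Skip from Skip.prems show ?case by (rule exec_SkipE) simp
next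
  case NAssign from NAssign.prems show ?case by (rule exec_NAssignE) simp
next
  case NStore from NStore.prems show ?case by (rule exec_NStoreE) simp
next
  case RAssign from RAssign.prems show ?case by (rule exec_RAssignE) simp
next
  case RStore from RStore.prems show ?case by (rule exec_RStoreE) simp
next
  case Seq from Seq.prems show ?case by (rule exec_SeqE) (metis Seq.IH)
next
  case IfTrue from IfTrue.prems show ?case
    by (rule exec_IfE) (use IfTrue.hyps(1) in \<open>auto dest!: IfTrue.IH\<close>)
next
  case IfFalse from IfFalse.prems show ?case
    by (rule exec_IfE) (use IfFalse.hyps(1) in \<open>auto dest!: IfFalse.IH\<close>)
next
  case WhileFalse from WhileFalse.prems show ?case
    by (rule exec_WhileE) (use WhileFalse.hyps in simp_all)
next
  case WhileTrue from WhileTrue.prems show ?case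
    by (rule exec_WhileE) (use WhileTrue.hyps(1) in \<open>auto dest!: WhileTrue.IH\<close>)
qed

text \<open>
  Input convention: register \<open>M\<close> holds the number of correspondences, the coordinates of
  the points are in the arrays \<open>p1\<close> to \<open>q3\<close> (indices start at 0), and all memory not
  used by the input is zero.
\<close>

definition input_array :: "((real^3) \<times> (real^3)) list \<Rightarrow> ((real^3) \<times> (real^3) \<Rightarrow> real) \<Rightarrow> nat \<Rightarrow> real" where
  "input_array C f i = (if i < length C then f (C ! i) else 0)"

definition input_state :: "((real^3) \<times> (real^3)) list \<Rightarrow> real \<Rightarrow> real^3 \<Rightarrow> state" where
  "input_state C \<epsilon> t =
    \<lparr> nvar = (\<lambda>_. 0)(''M'' := length C),
      narr = (\<lambda>_ _. 0),
      rvar = (\<lambda>_. 0)(''eps'' := \<epsilon>, ''t1'' := t $ 1, ''t2'' := t $ 2, ''t3'' := t $ 3),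
      rarr = (\<lambda>_ _. 0)(
        ''p1'' := input_array C (\<lambda>(p, q). p $ 1),
        ''p2'' := input_array C (\<lambda>(p, q). p $ 2),
        ''p3'' := input_array C (\<lambda>(p, q). p $ 3),
        ''q1'' := input_array C (\<lambda>(p, q). q $ 1),
        ''q2'' := input_array C (\<lambda>(p, q). q $ 2),
        ''q3'' := input_array C (\<lambda>(p, q). q $ 3)) \<rparr>"

end

theory Submission
  imports Defs "HOL-Real_Asymp.Real_Asymp"
begin

text \<open>
  Expanding the square, correspondence \<open>i\<close> votes for \<open>\<theta>\<close> iff \<open>K \<le> A cos \<theta> + B sin \<theta>\<close> for
  coefficients computed from the input, so its feasible angles form an arc, which is cut at
  \<open>0\<close> into at most three pairwise disjoint intervals in \<open>[0, 2 \<pi>]\<close>. The number of votes at \<open>\<theta>\<close> is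
  the number of left endpoints \<open>\<le> \<theta>\<close> minus the number of right endpoints \<open>< \<theta>\<close>, and it is
  maximal at a left endpoint. Hence left and right endpoints may be sorted independently
  (by a merge sort), after which one linear sweep finds the maximum.
\<close>

section \<open>Running programs with a time bound\<close>

text \<open>Loops are timed as a counter times a uniform bound on the body, so nested loops whose
  cost is linear only by amortisation would be overestimated. A merge pass and the sweep are
  therefore flat loops with a loop-free body: each iteration emits one entry, or advances one of two
  pointers. As programs have neither recursion nor division of naturals, merge sort works bottom-up,
  with run widths doubled by addition. Disjointness of the pieces matters because votes are counted
  as covering intervals: an angle in two pieces of one arc would be counted twice. This would happen
  at half-width \<open>pi\<close>, where neighbouring pieces touch, so the case
  \<open>K \<le> - r\<close> is stored as the whole circle instead. The cut itself is harmless: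
  \<open>0\<close> and \<open>2 * pi\<close> are the same angle but different points of the
  interval. Independent sorting is sound because the two counts depend only on the multisets of
  endpoints. Non-strict comparison on the left and strict comparison on the right encode closed
  intervals, so coinciding endpoints need no tie-breaking.\<close>

definition terminates :: "com \<Rightarrow> state \<Rightarrow> nat \<Rightarrow> (state \<Rightarrow> bool) \<Rightarrow> bool" where
  "terminates c s n Q \<longleftrightarrow> (\<exists>n' s'. exec c s n' s' \<and> n' \<le> n \<and> Q s')"

lemma terminates_mono:
  "terminates c s n Q \<Longrightarrow> n \<le> n' \<Longrightarrow> (\<And>s'. Q s' \<Longrightarrow> Q' s') \<Longrightarrow> terminates c s n' Q'"
  unfolding terminates_def by (meson order_trans)

lemma terminates_Seq:
  assumes "terminates c s m R" "\<And>s'. R s' \<Longrightarrow> terminates d s' n Q"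
  shows "terminates (SEQ c d) s (m + n) Q"
proof -
  obtain m' s' where 1: "exec c s m' s'" "m' \<le> m" "R s'"
    using assms(1) unfolding terminates_def by blast
  obtain n' s'' where 2: "exec d s' n' s''" "n' \<le> n" "Q s''"
    using assms(2)[OF 1(3)] unfolding terminates_def by blast
  from exec.Seq[OF 1(1) 2(1)] 1(2) 2(2,3) show ?thesis
    unfolding terminates_def using add_mono by blast
qed

text \<open>The index of the invariant bounds the remaining iterations. The factor is
  \<open>j + 1\<close> because the last, failing test of the guard has to be paid for as
  well.\<close>

lemma terminates_While:
  assumes body: "\<And>j s. I j s \<Longrightarrow> bval b s \<Longrightarrow> 0 < j \<and> terminates c s n (I (j - 1))"
    and init: "I j s"
  shows "terminates (WHILE b c) s ((j + 1) * (1 + bcost b + n)) (\<lambda>s. (\<exists>j. I j s) \<and> \<not> bval b s)"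
  using init
proof (induction j arbitrary: s)
  case 0
  then have "\<not> bval b s"
    using body by blast
  with 0 show ?case
    unfolding terminates_def by (intro exI[of _ "1 + bcost b"] exI[of _ s]) (auto intro: exec.WhileFalse[simplified])
next
  case (Suc j)
  show ?case
  proof (cases "bval b s")
    case False
    with Suc.prems show ?thesis
      unfolding terminates_def
      by (intro exI[of _ "1 + bcost b"] exI[of _ s]) (auto intro: exec.WhileFalse[simplified])
  next
    case True
    obtain n' s' where 1: "exec c s n' s'" "n' \<le> n" "I j s'"
      using body[OF Suc.prems True] unfolding terminates_def by auto
    obtain k s'' where 2: "exec (WHILE b c) s' k s''" "k \<le> (j + 1) * (1 + bcost b + n)"
      "(\<exists>j. I j s'') \<and> \<not> bval b s''"
      using Suc.IH[OF 1(3)] unfolding terminates_def by blast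
    have "1 + bcost b + n' + k \<le> (Suc j + 1) * (1 + bcost b + n)"
      using 1(2) 2(2) by simp
    with exec.WhileTrue[OF True 1(1) 2(1)] 2(3) show ?thesis
      unfolding terminates_def by blast
  qed
qed

section \<open>Loop-free programs as state functions\<close>

fun block :: "com list \<Rightarrow> com" where
  "block [] = SKIP"
| "block [c] = c"
| "block (c # d # cs) = SEQ c (block (d # cs))"

fun while_free :: "com \<Rightarrow> bool" where
  "while_free (SEQ c d) \<longleftrightarrow> while_free c \<and> while_free d"
| "while_free (IF b c d) \<longleftrightarrow> while_free c \<and> while_free d"
| "while_free (WHILE b c) \<longleftrightarrow> False"
| "while_free _ \<longleftrightarrow> True"

text \<open>Makes loop-free code computable by the simplifier, in place of derivations in
  \<open>exec\<close>. The clause for \<open>WHILE\<close> is a dummy, excluded by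
  \<open>while_free\<close> in the lemmas that link \<open>step\<close> to \<open>exec\<close>; the
  same holds for \<open>time_bound\<close>.\<close>

fun step :: "com \<Rightarrow> state \<Rightarrow> state" where
  "step SKIP s = s"
| "step (NAssign x e) s = s\<lparr>nvar := (nvar s)(x := nval e s)\<rparr>"
| "step (NStore a i e) s = s\<lparr>narr := (narr s)(a := (narr s a)(nval i s := nval e s))\<rparr>"
| "step (RAssign x e) s = s\<lparr>rvar := (rvar s)(x := rval e s)\<rparr>"
| "step (RStore a i e) s = s\<lparr>rarr := (rarr s)(a := (rarr s a)(nval i s := rval e s))\<rparr>"
| "step (SEQ c d) s = step d (step c s)"
| "step (IF b c d) s = (if bval b s then step c s else step d s)"
| "step (WHILE b c) s = s"

fun time_bound :: "com \<Rightarrow> nat" where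
  "time_bound SKIP = 1"
| "time_bound (NAssign x e) = 1 + ncost e"
| "time_bound (NStore a i e) = 1 + ncost i + ncost e"
| "time_bound (RAssign x e) = 1 + rcost e"
| "time_bound (RStore a i e) = 1 + ncost i + rcost e"
| "time_bound (SEQ c d) = time_bound c + time_bound d"
| "time_bound (IF b c d) = 1 + bcost b + max (time_bound c) (time_bound d)"
| "time_bound (WHILE b c) = 0"

lemma exec_step: "while_free c \<Longrightarrow> \<exists>n\<le>time_bound c. exec c s n (step c s)"
proof (induction c arbitrary: s)
  case (SEQ c d)
  from SEQ.prems obtain m where m: "m \<le> time_bound c" "exec c s m (step c s)"
    using SEQ.IH(1) by auto
  from SEQ.prems obtain n where n: "n \<le> time_bound d" "exec d (step c s) n (step d (step c s))"
    using SEQ.IH(2) by auto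
  from m n show ?case
    by (auto intro!: exI[of _ "m + n"] exec.Seq)
next
  case (IF b c d)
  show ?case
  proof (cases "bval b s")
    case True
    from IF.prems obtain n where "n \<le> time_bound c" "exec c s n (step c s)"
      using IF.IH(1) by auto
    with True show ?thesis
      by (auto intro!: exI[of _ "1 + bcost b + n"] exec.IfTrue[simplified])
  next
    case False
    from IF.prems obtain n where "n \<le> time_bound d" "exec d s n (step d s)"
      using IF.IH(2) by auto
    with False show ?thesis
      by (auto intro!: exI[of _ "1 + bcost b + n"] exec.IfFalse[simplified])
  qed
next
  case (WHILE b c)
  then show ?case by simp
qed (rule exI, rule conjI, rule order_refl, simp only: time_bound.simps step.simps, rule exec.intros)+

lemma terminates_step:
  "while_free c \<Longrightarrow> time_bound c \<le> n \<Longrightarrow> Q (step c s) \<Longrightarrow> terminates c s n Q"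
  unfolding terminates_def using exec_step[of c s] by (meson order_trans)

section \<open>Frame properties read off the program text\<close>

fun nvars_written :: "com \<Rightarrow> name set" where
  "nvars_written (NAssign x e) = {x}"
| "nvars_written (SEQ c d) = nvars_written c \<union> nvars_written d"
| "nvars_written (IF b c d) = nvars_written c \<union> nvars_written d"
| "nvars_written (WHILE b c) = nvars_written c"
| "nvars_written _ = {}"

fun rarrs_written :: "com \<Rightarrow> name set" where
  "rarrs_written (RStore a i e) = {a}"
| "rarrs_written (SEQ c d) = rarrs_written c \<union> rarrs_written d"
| "rarrs_written (IF b c d) = rarrs_written c \<union> rarrs_written d"
| "rarrs_written (WHILE b c) = rarrs_written c"
| "rarrs_written _ = {}"

fun rvars_written :: "com \<Rightarrow> name set" where
  "rvars_written (RAssign x e) = {x}"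
| "rvars_written (SEQ c d) = rvars_written c \<union> rvars_written d"
| "rvars_written (IF b c d) = rvars_written c \<union> rvars_written d"
| "rvars_written (WHILE b c) = rvars_written c"
| "rvars_written _ = {}"

lemma exec_frame:
  assumes "exec c s n s'"
  shows "x \<notin> nvars_written c \<Longrightarrow> nvar s' x = nvar s x"
    and "a \<notin> rarrs_written c \<Longrightarrow> rarr s' a = rarr s a"
    and "y \<notin> rvars_written c \<Longrightarrow> rvar s' y = rvar s y"
  using assms by (induction rule: exec.induct) auto

lemma step_frame:
  assumes "while_free c"
  shows "x \<notin> nvars_written c \<Longrightarrow> nvar (step c s) x = nvar s x"
    and "a \<notin> rarrs_written c \<Longrightarrow> rarr (step c s) a = rarr s a"
    and "y \<notin> rvars_written c \<Longrightarrow> rvar (step c s) y = rvar s y"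
  using exec_step[OF assms, of s] exec_frame by blast+

text \<open>Lets a correctness lemma state only what a program achieves. That \<open>m\<close> or
  the other endpoint array survives sorting is added afterwards by syntax alone.\<close>

lemma terminates_frame:
  assumes "terminates c s n Q"
  shows "terminates c s n (\<lambda>s'. Q s' \<and> (\<forall>x. x \<notin> nvars_written c \<longrightarrow> nvar s' x = nvar s x)
    \<and> (\<forall>a. a \<notin> rarrs_written c \<longrightarrow> rarr s' a = rarr s a))"
  using assms exec_frame unfolding terminates_def by blast

section \<open>Merge sort\<close>

definition blocks_sorted :: "nat \<Rightarrow> (nat \<Rightarrow> real) \<Rightarrow> nat \<Rightarrow> bool" where
  "blocks_sorted w X m \<longleftrightarrow>
    (\<forall>c i j. c * w \<le> i \<longrightarrow> i \<le> j \<longrightarrow> j < c * w + w \<longrightarrow> j < m \<longrightarrow> X i \<le> X j)"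

text \<open>
  The invariant of a merge pass from \<open>X\<close> to \<open>Y\<close>: \<open>Y\<close> is filled up to \<open>k\<close>, and the runs being merged
  are \<open>[lo, mid)\<close> and \<open>[mid, hi)\<close>, read up to \<open>a\<close> and \<open>b\<close>. The case \<open>hi = 0\<close> is the start of the pass,
  when no pair of runs has been selected yet.
\<close>

definition merging ::
  "(nat \<Rightarrow> real) \<Rightarrow> (nat \<Rightarrow> real) \<Rightarrow> nat \<Rightarrow> nat \<Rightarrow> nat \<Rightarrow> nat \<Rightarrow> nat \<Rightarrow> nat \<Rightarrow> nat \<Rightarrow> nat \<Rightarrow> bool"
where
  "merging X Y w m lo k a mid b hi \<longleftrightarrow>
     (\<exists>d. lo = d * (2 * w)) \<and>
     lo \<le> a \<and> a \<le> mid \<and> mid \<le> b \<and> b \<le> hi \<and> hi \<le> m \<and> hi \<le> lo + 2 * w \<and>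
     (hi = m \<or> hi = lo + 2 * w \<or> hi = 0) \<and>
     a + b = k + mid \<and>
     (\<forall>i j. a \<le> i \<longrightarrow> i \<le> j \<longrightarrow> j < mid \<longrightarrow> X i \<le> X j) \<and>
     (\<forall>i j. b \<le> i \<longrightarrow> i \<le> j \<longrightarrow> j < hi \<longrightarrow> X i \<le> X j) \<and>
     blocks_sorted (2 * w) Y k \<and>
     (\<forall>i j. lo \<le> i \<longrightarrow> i < k \<longrightarrow> a \<le> j \<longrightarrow> j < mid \<longrightarrow> Y i \<le> X j) \<and>
     (\<forall>i j. lo \<le> i \<longrightarrow> i < k \<longrightarrow> b \<le> j \<longrightarrow> j < hi \<longrightarrow> Y i \<le> X j) \<and>
     mset (map Y [0..<k]) = mset (map X [0..<a]) + mset (map X [mid..<b])"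

lemma merging_init: "merging X Y w m 0 0 0 0 0 0"
  unfolding merging_def blocks_sorted_def by simp

lemma merging_bounds:
  assumes "merging X Y w m lo k a mid b hi"
  shows "k \<le> hi" "lo \<le> k" "hi \<le> m"
  using assms unfolding merging_def by auto

lemma upt_append: "i \<le> j \<Longrightarrow> j \<le> k \<Longrightarrow> [i..<j] @ [j..<k] = [i..<k]"
  using upt_add_eq_append[of i j "k - j"] by simp

text \<open>At \<open>k = hi\<close> the equation \<open>a + b = k + mid\<close> forces both runs to
  be used up. Since \<open>k < m\<close> rules out \<open>hi = m\<close>, the position
  \<open>k\<close> is again a multiple of \<open>2 * w\<close>, and the next pair of runs starts
  there.\<close>

lemma merging_refill:
  assumes "merging X Y w m lo k a mid b hi" "\<not> k < hi" "k < m" and sorted: "blocks_sorted w X m"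
  shows "merging X Y w m k k k (min (k + w) m) (min (k + w) m) (min (min (k + w) m + w) m)"
proof -
  let ?mid = "min (k + w) m" and ?hi = "min (min (k + w) m + w) m"
  have k: "k = hi"
    using merging_bounds[OF assms(1)] assms(2) by simp
  then have ab: "a = mid" "b = hi"
    using assms(1) unfolding merging_def by auto
  have "hi = lo + 2 * w \<or> hi = 0"
    using assms(1,3) k unfolding merging_def by auto
  then obtain d where d: "k = d * (2 * w)"
  proof
    assume "hi = lo + 2 * w"
    moreover obtain d where "lo = d * (2 * w)"
      using assms(1) unfolding merging_def by blast
    ultimately show ?thesis
      using k that[of "Suc d"] by simp
  qed (use k that[of 0] in simp)
  \<comment> \<open>With \<open>k = d * (2 * w)\<close>, the next two source runs are the blocks of
    width \<open>w\<close> numbered \<open>2 * d\<close> and \<open>2 * d + 1\<close>.\<close>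
  have 1: "X i \<le> X j" if "k \<le> i" "i \<le> j" "j < ?mid" for i j
    using sorted[unfolded blocks_sorted_def, rule_format, of "2 * d" i j] that d by simp
  have 2: "X i \<le> X j" if "?mid \<le> i" "i \<le> j" "j < ?hi" for i j
  proof -
    have "k + w \<le> i" "j < k + w + w" "j < m"
      using that by auto
    then show ?thesis
      using sorted[unfolded blocks_sorted_def, rule_format, of "2 * d + 1" i j] that(2) d
      by (simp add: algebra_simps)
  qed
  have "mset (map Y [0..<k]) = mset (map X ([0..<mid] @ [mid..<b]))"
    using assms(1) ab unfolding merging_def by simp
  also have "\<dots> = mset (map X [0..<k])"
    using assms(1) ab k unfolding merging_def by (subst upt_append) auto
  finally show ?thesis
    using 1 2 assms(1,3) d unfolding merging_def by auto
qed

text \<open>An output block containing \<open>k\<close> cannot start before \<open>lo\<close>,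
  because \<open>lo\<close> is itself a block boundary not beyond \<open>k\<close>. So the new entry
  has to be compared only with entries from \<open>lo\<close> on.\<close>

lemma merging_blocks_snoc:
  assumes "merging X Y w m lo k a mid b hi" "k < hi" and le: "\<forall>i. lo \<le> i \<longrightarrow> i < k \<longrightarrow> Y i \<le> x"
  shows "blocks_sorted (2 * w) (Y(k := x)) (Suc k)"
  unfolding blocks_sorted_def
proof (intro allI impI)
  fix c i j
  assume *: "c * (2 * w) \<le> i" "i \<le> j" "j < c * (2 * w) + 2 * w" "j < Suc k"
  show "(Y(k := x)) i \<le> (Y(k := x)) j"
  proof (cases "j = k")
    case False
    then show ?thesis
      using * assms(1) unfolding merging_def blocks_sorted_def by auto
  next
    case True
    obtain d where d: "lo = d * (2 * w)"
      using assms(1) unfolding merging_def by blast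
    have "lo \<le> k" "k < lo + 2 * w"
      using assms(1,2) unfolding merging_def by auto
    then have "d * (2 * w) < Suc c * (2 * w)"
      using True d * by simp
    then have "d \<le> c"
      by (metis less_Suc_eq_le mult_less_cancel2)
    then have "lo \<le> c * (2 * w)"
      using d by simp
    then show ?thesis
      using True * le by auto
  qed
qed

text \<open>The head of the left run is minimal among everything unread: its own run is sorted, and
  if the right run is not exhausted, its head is not smaller. Ties go to the left.\<close>

lemma merging_left:
  assumes M: "merging X Y w m lo k a mid b hi" and "k < hi" "a < mid" "\<not> (b < hi \<and> X b < X a)"
  shows "merging X (Y(k := X a)) w m lo (Suc k) (Suc a) mid b hi"
proof -
  have Xb: "X a \<le> X j" if "b \<le> j" "j < hi" for j
  proof -
    have "X a \<le> X b"
      using assms(4) that by auto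
    also have "\<dots> \<le> X j"
      using M that unfolding merging_def by auto
    finally show ?thesis .
  qed
  have bl: "blocks_sorted (2 * w) (Y(k := X a)) (Suc k)"
    using M assms(3) by (intro merging_blocks_snoc[OF M assms(2)]) (auto simp: merging_def)
  have ms: "mset (map (Y(k := X a)) [0..<Suc k]) = mset (map X [0..<Suc a]) + mset (map X [mid..<b])"
  proof -
    have "map (Y(k := X a)) [0..<k] = map Y [0..<k]"
      by simp
    then show ?thesis
      using M unfolding merging_def by (simp del: map_eq_conv map_fun_upd)
  qed
  have "lo \<le> i \<Longrightarrow> i < Suc k \<Longrightarrow> Suc a \<le> j \<Longrightarrow> j < mid \<Longrightarrow> (Y(k := X a)) i \<le> X j" for i j
    using M unfolding merging_def by (cases "i = k") auto
  moreover have "lo \<le> i \<Longrightarrow> i < Suc k \<Longrightarrow> b \<le> j \<Longrightarrow> j < hi \<Longrightarrow> (Y(k := X a)) i \<le> X j" for i j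
    using M Xb unfolding merging_def by (cases "i = k") auto
  ultimately show ?thesis
    using M bl ms assms(2,3) unfolding merging_def by (auto simp del: fun_upd_apply upt_Suc)
qed

lemma merging_right:
  assumes M: "merging X Y w m lo k a mid b hi" and "k < hi" "\<not> (a < mid \<and> \<not> (b < hi \<and> X b < X a))"
  shows "merging X (Y(k := X b)) w m lo (Suc k) a mid (Suc b) hi"
proof -
  \<comment> \<open>Either the left run is exhausted, and \<open>a = mid\<close> gives
    \<open>b = k < hi\<close>, or the negated test itself contains \<open>b < hi\<close>.\<close>
  have b: "b < hi"
    using M assms(2,3) unfolding merging_def by auto
  have Xa: "X b \<le> X j" if "a \<le> j" "j < mid" for j
  proof -
    have "X b \<le> X a"
      using assms(3) that by auto
    also have "\<dots> \<le> X j"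
      using M that unfolding merging_def by auto
    finally show ?thesis .
  qed
  have bl: "blocks_sorted (2 * w) (Y(k := X b)) (Suc k)"
    using M b by (intro merging_blocks_snoc[OF M assms(2)]) (auto simp: merging_def)
  have ms: "mset (map (Y(k := X b)) [0..<Suc k]) = mset (map X [0..<a]) + mset (map X [mid..<Suc b])"
  proof -
    have "map (Y(k := X b)) [0..<k] = map Y [0..<k]"
      by simp
    then show ?thesis
      using M unfolding merging_def by (simp del: map_eq_conv map_fun_upd)
  qed
  have "lo \<le> i \<Longrightarrow> i < Suc k \<Longrightarrow> a \<le> j \<Longrightarrow> j < mid \<Longrightarrow> (Y(k := X b)) i \<le> X j" for i j
    using M Xa unfolding merging_def by (cases "i = k") auto
  moreover have "lo \<le> i \<Longrightarrow> i < Suc k \<Longrightarrow> Suc b \<le> j \<Longrightarrow> j < hi \<Longrightarrow> (Y(k := X b)) i \<le> X j" for i j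
    using M unfolding merging_def by (cases "i = k") auto
  ultimately show ?thesis
    using M bl ms b unfolding merging_def by (auto simp del: fun_upd_apply upt_Suc)
qed

lemma merging_finished:
  assumes M: "merging X Y w m lo k a mid b hi" and "\<not> k < m"
  shows "blocks_sorted (2 * w) Y m" "mset (map Y [0..<m]) = mset (map X [0..<m])"
proof -
  have k: "k = m" "hi = m"
    using merging_bounds[OF M] assms(2) by auto
  then have ab: "a = mid" "b = m" "mid \<le> m"
    using M unfolding merging_def by auto
  show "blocks_sorted (2 * w) Y m"
    using M k unfolding merging_def by blast
  have "mset (map Y [0..<m]) = mset (map X ([0..<mid] @ [mid..<m]))"
    using M ab k unfolding merging_def by simp
  then show "mset (map Y [0..<m]) = mset (map X [0..<m])"
    using ab(3) by (subst (asm) upt_append) auto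
qed

text \<open>Truncated subtraction yields the minimum without a branch.\<close>

definition nmin :: "nexp \<Rightarrow> nexp \<Rightarrow> nexp" where
  "nmin e f = NSub e (NSub e f)"

lemma nmin_simps [simp]:
  "nval (nmin e f) s = min (nval e s) (nval f s)"
  "ncost (nmin e f) = 2 + 2 * ncost e + ncost f"
  unfolding nmin_def by auto

definition refill :: com where
  "refill = block [
     NAssign ''a'' (NVar ''k''),
     NAssign ''mid'' (nmin (NAdd (NVar ''k'') (NVar ''w'')) (NVar ''m'')),
     NAssign ''b'' (NVar ''mid''),
     NAssign ''hi'' (nmin (NAdd (NVar ''mid'') (NVar ''w'')) (NVar ''m''))]"

definition select_next :: "name \<Rightarrow> com" where
  "select_next x = block [
     IF (BAnd (NLess (NVar ''a'') (NVar ''mid''))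
          (BNot (BAnd (NLess (NVar ''b'') (NVar ''hi''))
             (RLess (RArr x (NVar ''b'')) (RArr x (NVar ''a''))))))
       (SEQ (RStore ''tmp'' (NVar ''k'') (RArr x (NVar ''a'')))
         (NAssign ''a'' (NAdd (NVar ''a'') (NConst 1))))
       (SEQ (RStore ''tmp'' (NVar ''k'') (RArr x (NVar ''b'')))
         (NAssign ''b'' (NAdd (NVar ''b'') (NConst 1)))),
     NAssign ''k'' (NAdd (NVar ''k'') (NConst 1))]"

definition merge_step :: "name \<Rightarrow> com" where
  "merge_step x =
     SEQ (IF (NLess (NVar ''k'') (NVar ''hi'')) SKIP refill) (select_next x)"

definition merge_pass :: "name \<Rightarrow> com" where
  "merge_pass x = SEQ
     (block [NAssign ''k'' (NConst 0), NAssign ''a'' (NConst 0), NAssign ''mid'' (NConst 0),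
        NAssign ''b'' (NConst 0), NAssign ''hi'' (NConst 0)])
     (WHILE (NLess (NVar ''k'') (NVar ''m'')) (merge_step x))"

text \<open>Array names are fixed in the program text, so source and buffer cannot swap roles
  between passes. Copying is linear, like the pass itself.\<close>

definition copy_back :: "name \<Rightarrow> com" where
  "copy_back x = SEQ (NAssign ''k'' (NConst 0))
     (WHILE (NLess (NVar ''k'') (NVar ''m''))
       (SEQ (RStore x (NVar ''k'') (RArr ''tmp'' (NVar ''k'')))
         (NAssign ''k'' (NAdd (NVar ''k'') (NConst 1)))))"

definition merge_sort :: "name \<Rightarrow> com" where
  "merge_sort x = SEQ (NAssign ''w'' (NConst 1))
     (WHILE (NLess (NVar ''w'') (NVar ''m''))
       (block [merge_pass x, copy_back x, NAssign ''w'' (NAdd (NVar ''w'') (NVar ''w''))]))"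

text \<open>The start \<open>lo\<close> of the current output block is a ghost variable: no register
  holds it. The number \<open>j\<close> of entries still to be written serves as the loop
  counter.\<close>

definition merging_state :: "name \<Rightarrow> (nat \<Rightarrow> real) \<Rightarrow> nat \<Rightarrow> nat \<Rightarrow> nat \<Rightarrow> state \<Rightarrow> bool" where
  "merging_state x X w m j s \<longleftrightarrow>
     rarr s x = X \<and> nvar s ''w'' = w \<and> nvar s ''m'' = m \<and> j = m - nvar s ''k'' \<and>
     (\<exists>lo. merging X (rarr s ''tmp'') w m lo (nvar s ''k'') (nvar s ''a'') (nvar s ''mid'')
        (nvar s ''b'') (nvar s ''hi''))"

lemma step_refill:
  "step refill s = s\<lparr>nvar := (nvar s)(''a'' := nvar s ''k'',
     ''mid'' := min (nvar s ''k'' + nvar s ''w'') (nvar s ''m''),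
     ''b'' := min (nvar s ''k'' + nvar s ''w'') (nvar s ''m''),
     ''hi'' := min (min (nvar s ''k'' + nvar s ''w'') (nvar s ''m'') + nvar s ''w'') (nvar s ''m''))\<rparr>"
  by (simp add: refill_def)

lemma merge_step_correct:
  assumes x: "x \<noteq> ''tmp''" and w: "0 < w" and sorted: "blocks_sorted w X m"
    and I: "merging_state x X w m j s" and k: "nvar s ''k'' < m"
  shows "merging_state x X w m (j - 1) (step (merge_step x) s)"
proof -
  define s1 where "s1 = step (IF (NLess (NVar ''k'') (NVar ''hi'')) SKIP refill) s"
  have s1: "merging_state x X w m j s1 \<and> nvar s1 ''k'' < nvar s1 ''hi''"
  proof (cases "nvar s ''k'' < nvar s ''hi''")
    case True
    then show ?thesis
      using I unfolding s1_def by simp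
  next
    case False
    obtain lo where lo:
      "merging X (rarr s ''tmp'') w m lo (nvar s ''k'') (nvar s ''a'') (nvar s ''mid'')
        (nvar s ''b'') (nvar s ''hi'')"
      using I unfolding merging_state_def by blast
    note M = merging_refill[OF lo False k sorted]
    have s1: "s1 = step refill s"
      using False by (simp add: s1_def)
    \<comment> \<open>Here \<open>0 < w\<close> is essential: a refill always provides at least one
      unread entry, as \<open>select_next\<close> requires.\<close>
    have "nvar s ''k'' < min (min (nvar s ''k'' + w) m + w) m"
      using k w by simp
    moreover have "nvar s ''w'' = w" "nvar s ''m'' = m" "rarr s x = X" "j = m - nvar s ''k''"
      using I unfolding merging_state_def by auto
    moreover have "\<exists>lo. merging X (rarr s ''tmp'') w m lo (nvar s ''k'') (nvar s ''k'')
       (min (nvar s ''k'' + w) m) (min (nvar s ''k'' + w) m) (min (min (nvar s ''k'' + w) m + w) m)"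
      by (rule exI, rule M)
    ultimately show ?thesis
      unfolding merging_state_def s1 step_refill by (simp del: min_less_iff_conj)
  qed
  then obtain lo where M:
      "merging X (rarr s1 ''tmp'') w m lo (nvar s1 ''k'') (nvar s1 ''a'') (nvar s1 ''mid'')
        (nvar s1 ''b'') (nvar s1 ''hi'')"
    unfolding merging_state_def by blast
  have X: "rarr s1 x = X" and w: "nvar s1 ''w'' = w" "nvar s1 ''m'' = m" and j: "j = m - nvar s1 ''k''"
    using s1 unfolding merging_state_def by auto
  have "merging_state x X w m (j - 1) (step (select_next x) s1)"
  proof (cases "nvar s1 ''a'' < nvar s1 ''mid'' \<and>
      \<not> (nvar s1 ''b'' < nvar s1 ''hi'' \<and> X (nvar s1 ''b'') < X (nvar s1 ''a''))")
    case True
    then have "merging X ((rarr s1 ''tmp'')(nvar s1 ''k'' := X (nvar s1 ''a''))) w m lo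
        (Suc (nvar s1 ''k'')) (Suc (nvar s1 ''a'')) (nvar s1 ''mid'') (nvar s1 ''b'') (nvar s1 ''hi'')"
      using merging_left[OF M] s1 by blast
    then show ?thesis
      unfolding merging_state_def using True x X w j by (auto simp: select_next_def)
  next
    case False
    then have "merging X ((rarr s1 ''tmp'')(nvar s1 ''k'' := X (nvar s1 ''b''))) w m lo
        (Suc (nvar s1 ''k'')) (nvar s1 ''a'') (nvar s1 ''mid'') (Suc (nvar s1 ''b'')) (nvar s1 ''hi'')"
      using merging_right[OF M] s1 by blast
    then show ?thesis
      unfolding merging_state_def using False x X w j by (simp add: select_next_def) auto
  qed
  then show ?thesis
    by (simp add: merge_step_def s1_def)
qed

lemma merge_pass_correct:
  assumes x: "x \<noteq> ''tmp''" and w: "0 < nvar s ''w''" and sorted: "blocks_sorted (nvar s ''w'') (rarr s x) (nvar s ''m'')"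
  shows "terminates (merge_pass x) s (100 * (nvar s ''m'' + 1)) (\<lambda>s'.
    blocks_sorted (2 * nvar s ''w'') (rarr s' ''tmp'') (nvar s ''m'') \<and>
    mset (map (rarr s' ''tmp'') [0..<nvar s ''m'']) = mset (map (rarr s x) [0..<nvar s ''m'']))"
proof -
  let ?X = "rarr s x" and ?w = "nvar s ''w''" and ?m = "nvar s ''m''"
  let ?I = "merging_state x ?X ?w ?m"
  let ?init = "block [NAssign ''k'' (NConst 0), NAssign ''a'' (NConst 0), NAssign ''mid'' (NConst 0),
     NAssign ''b'' (NConst 0), NAssign ''hi'' (NConst 0)]"
  let ?b = "NLess (NVar ''k'') (NVar ''m'')"
  have body: "0 < j \<and> terminates (merge_step x) s' 85 (?I (j - 1))"
    if I: "?I j s'" and b: "bval ?b s'" for j s'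
  proof -
    have k: "nvar s' ''k'' < ?m" "0 < j"
      using I b unfolding merging_state_def by auto
    have "while_free (merge_step x)" "time_bound (merge_step x) \<le> 85"
      by (simp_all add: merge_step_def refill_def select_next_def)
    with k(2) show ?thesis
      using merge_step_correct[OF x w sorted I k(1)] by (simp add: terminates_step)
  qed
  have "\<exists>lo. merging ?X (rarr s ''tmp'') ?w ?m lo 0 0 0 0 0"
    using merging_init by blast
  then have init: "terminates ?init s 10 (?I ?m)"
    by (intro terminates_step) (simp_all add: merging_state_def)
  have "terminates (SEQ ?init (WHILE ?b (merge_step x))) s
      (10 + (?m + 1) * (1 + bcost ?b + 85)) (\<lambda>s'. (\<exists>j. ?I j s') \<and> \<not> bval ?b s')"
    by (rule terminates_Seq[OF init]) (rule terminates_While[OF body])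
  then have "terminates (SEQ ?init (WHILE ?b (merge_step x))) s (100 * (?m + 1)) (\<lambda>s'.
    blocks_sorted (2 * ?w) (rarr s' ''tmp'') ?m \<and>
    mset (map (rarr s' ''tmp'') [0..<?m]) = mset (map ?X [0..<?m]))"
    by (rule terminates_mono) (auto simp: merging_state_def dest: merging_finished)
  then show ?thesis
    by (simp add: merge_pass_def)
qed

lemma copy_back_correct:
  assumes x: "x \<noteq> ''tmp''"
  shows "terminates (copy_back x) s (20 * (nvar s ''m'' + 1))
    (\<lambda>s'. \<forall>i<nvar s ''m''. rarr s' x i = rarr s ''tmp'' i)"
proof -
  let ?m = "nvar s ''m''" and ?b = "NLess (NVar ''k'') (NVar ''m'')"
  let ?body = "SEQ (RStore x (NVar ''k'') (RArr ''tmp'' (NVar ''k'')))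
         (NAssign ''k'' (NAdd (NVar ''k'') (NConst 1)))"
  let ?I = "\<lambda>j s'. nvar s' ''m'' = ?m \<and> rarr s' ''tmp'' = rarr s ''tmp'' \<and> j = ?m - nvar s' ''k'' \<and>
    (\<forall>i<nvar s' ''k''. rarr s' x i = rarr s ''tmp'' i)"
  have body: "0 < j \<and> terminates ?body s' 8 (?I (j - 1))" if "?I j s'" "bval ?b s'" for j s'
    using that x by (auto intro!: terminates_step simp: less_Suc_eq)
  have init: "terminates (NAssign ''k'' (NConst 0)) s 2 (?I ?m)"
    by (intro terminates_step) simp_all
  have "terminates (copy_back x) s (2 + (?m + 1) * (1 + bcost ?b + 8))
      (\<lambda>s'. (\<exists>j. ?I j s') \<and> \<not> bval ?b s')"
    unfolding copy_back_def by (rule terminates_Seq[OF init]) (rule terminates_While[OF body])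
  then show ?thesis
    by (rule terminates_mono) auto
qed

text \<open>After \<open>p\<close> passes the width is \<open>2 ^ p\<close>, so the guard
  \<open>w < m\<close> together with \<open>m \<le> 2 ^ P\<close> forces \<open>p < P\<close>: there
  are at most \<open>P\<close> passes. Taking \<open>P\<close> as a parameter keeps logarithms out
  of the reasoning about programs.\<close>

lemma merge_sort_correct:
  assumes x: "x \<noteq> ''tmp''" and P: "nvar s ''m'' \<le> 2 ^ P"
  shows "terminates (merge_sort x) s (150 * (P + 1) * (nvar s ''m'' + 1)) (\<lambda>s'.
    (\<forall>i j. i \<le> j \<longrightarrow> j < nvar s ''m'' \<longrightarrow> rarr s' x i \<le> rarr s' x j) \<and>
    mset (map (rarr s' x) [0..<nvar s ''m'']) = mset (map (rarr s x) [0..<nvar s ''m'']))"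
proof -
  let ?m = "nvar s ''m''" and ?b = "NLess (NVar ''w'') (NVar ''m'')"
  let ?double = "NAssign ''w'' (NAdd (NVar ''w'') (NVar ''w''))"
  let ?body = "block [merge_pass x, copy_back x, ?double]"
  define I where "I j s' \<longleftrightarrow> nvar s' ''m'' = ?m \<and> (\<exists>p. nvar s' ''w'' = 2 ^ p \<and> p + j = P) \<and>
    blocks_sorted (nvar s' ''w'') (rarr s' x) ?m \<and>
    mset (map (rarr s' x) [0..<?m]) = mset (map (rarr s x) [0..<?m])" for j and s' :: state
  have body: "0 < j \<and> terminates ?body s' (120 * (?m + 1) + 4) (I (j - 1))"
    if I: "I j s'" and b: "bval ?b s'" for j s'
  proof -
    obtain p where p: "nvar s' ''w'' = 2 ^ p" "p + j = P"
      using I unfolding I_def by blast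
    have j: "0 < j"
      using I b p P unfolding I_def by (cases j) auto
    have m: "nvar s' ''m'' = ?m"
      using I unfolding I_def by simp
    have sorted: "blocks_sorted (nvar s' ''w'') (rarr s' x) (nvar s' ''m'')"
      using I unfolding I_def by simp
    have w: "0 < nvar s' ''w''"
      using p(1) by simp
    let ?Q1 = "\<lambda>s1. nvar s1 ''m'' = ?m \<and> nvar s1 ''w'' = 2 ^ p \<and>
      blocks_sorted (2 * 2 ^ p) (rarr s1 ''tmp'') ?m \<and>
      mset (map (rarr s1 ''tmp'') [0..<?m]) = mset (map (rarr s x) [0..<?m])"
    let ?Q2 = "\<lambda>s1. nvar s1 ''m'' = ?m \<and> nvar s1 ''w'' = 2 ^ p \<and>
      blocks_sorted (2 * 2 ^ p) (rarr s1 x) ?m \<and>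
      mset (map (rarr s1 x) [0..<?m]) = mset (map (rarr s x) [0..<?m])"
    have "terminates (merge_pass x) s' (100 * (?m + 1)) ?Q1"
      using terminates_frame[OF merge_pass_correct[OF x w sorted]]
      by (rule terminates_mono)
        (use I in \<open>auto simp: p m I_def merge_pass_def merge_step_def refill_def select_next_def\<close>)
    moreover have "terminates (SEQ (copy_back x) ?double) s1 (20 * (?m + 1) + 4) (I (j - 1))"
      if Q1: "?Q1 s1" for s1
    proof (rule terminates_Seq)
      \<comment> \<open>Copying guarantees agreement with the buffer only below \<open>m\<close>, so
        the properties to be transferred must depend on those entries alone.\<close>
      have eq: "blocks_sorted (2 * 2 ^ p) Y ?m \<and> mset (map Y [0..<?m]) = mset (map (rarr s x) [0..<?m])"
        if "\<forall>i<?m. Y i = rarr s1 ''tmp'' i" for Y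
      proof -
        have "map Y [0..<?m] = map (rarr s1 ''tmp'') [0..<?m]"
          using that by simp
        then show ?thesis
          using Q1 that unfolding blocks_sorted_def by (auto simp del: map_eq_conv)
      qed
      show "terminates (copy_back x) s1 (20 * (?m + 1)) ?Q2"
        using terminates_frame[OF copy_back_correct[OF x]]
        by (rule terminates_mono) (use Q1 eq in \<open>auto simp: copy_back_def\<close>)
      show "terminates ?double s2 4 (I (j - 1))" if "?Q2 s2" for s2
        using that p j
        by (intro terminates_step) (auto simp: I_def mult_2 intro!: exI[of _ "Suc p"])
    qed
    ultimately have "terminates ?body s' (100 * (?m + 1) + (20 * (?m + 1) + 4)) (I (j - 1))"
      unfolding block.simps by (rule terminates_Seq)
    with j show ?thesis
      by simp
  qed
  have "blocks_sorted (Suc 0) (rarr s x) ?m"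
    unfolding blocks_sorted_def
  proof (intro allI impI)
    fix c i j assume "c * Suc 0 \<le> i" "i \<le> j" "j < c * Suc 0 + Suc 0"
    then have "i = j"
      by simp
    then show "rarr s x i \<le> rarr s x j"
      by simp
  qed
  then have init: "terminates (NAssign ''w'' (NConst 1)) s 2 (I P)"
    by (intro terminates_step) (auto simp: I_def intro: exI[of _ 0])
  have "terminates (merge_sort x) s (2 + (P + 1) * (1 + bcost ?b + (120 * (?m + 1) + 4)))
      (\<lambda>s'. (\<exists>j. I j s') \<and> \<not> bval ?b s')"
    unfolding merge_sort_def by (rule terminates_Seq[OF init]) (rule terminates_While[OF body])
  then show ?thesis
  proof (rule terminates_mono)
    show "2 + (P + 1) * (1 + bcost ?b + (120 * (?m + 1) + 4)) \<le> 150 * (P + 1) * (?m + 1)"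
      by (simp add: algebra_simps)
    fix s' assume "(\<exists>j. I j s') \<and> \<not> bval ?b s'"
    then have sorted: "blocks_sorted (nvar s' ''w'') (rarr s' x) ?m" "?m \<le> nvar s' ''w''"
      and ms: "mset (map (rarr s' x) [0..<?m]) = mset (map (rarr s x) [0..<?m])"
      by (auto simp: I_def)
    \<comment> \<open>On exit \<open>m \<le> w\<close>, so block \<open>0\<close> is the whole
      range.\<close>
    have "rarr s' x i \<le> rarr s' x j" if "i \<le> j" "j < ?m" for i j
      using sorted(1)[unfolded blocks_sorted_def, rule_format, of 0 i j] sorted(2) that by simp
    with ms show "(\<forall>i j. i \<le> j \<longrightarrow> j < ?m \<longrightarrow> rarr s' x i \<le> rarr s' x j) \<and>
        mset (map (rarr s' x) [0..<?m]) = mset (map (rarr s x) [0..<?m])"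
      by blast
  qed
qed

section \<open>Feasible angles of one correspondence\<close>

definition covers :: "real \<Rightarrow> real \<times> real \<Rightarrow> bool" where
  "covers \<theta> I \<longleftrightarrow> fst I \<le> \<theta> \<and> \<theta> \<le> snd I"

text \<open>A piece with reversed endpoints covers nothing, but it would contribute
  \<open>-1\<close> to the difference of endpoint counts at angles strictly between its ends. Hence
  such pieces must be dropped before sorting.\<close>

definition nonempty_interval :: "real \<times> real \<Rightarrow> bool" where
  "nonempty_interval I \<longleftrightarrow> fst I \<le> snd I"

text \<open>A two-argument arctangent with values in \<open>[0, 2 * pi]\<close>, built from an
  operation that the machine has. It is meaningful only for \<open>(A, B)\<close> different from the
  origin.\<close>

definition polar_angle :: "real \<Rightarrow> real \<Rightarrow> real" where
  "polar_angle A B =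
    (let a = arccos (A / sqrt (A\<^sup>2 + B\<^sup>2)) in if B < 0 then 2 * pi - a else a)"

text \<open>The arc \<open>[l, u]\<close> and its translates by \<open>-2 \<pi>\<close> and \<open>2 \<pi>\<close>, clipped to \<open>[0, 2 \<pi>]\<close>.\<close>

definition arc_pieces :: "real \<Rightarrow> real \<Rightarrow> (real \<times> real) list" where
  "arc_pieces l u = [(max 0 l, min (2 * pi) u), (0, u - 2 * pi), (l + 2 * pi, 2 * pi)]"

text \<open>The middle case \<open>- r < K \<le> r\<close> implies \<open>0 < r\<close>, so its
  divisions by \<open>r\<close> are genuine and its half-width is below \<open>pi\<close>. The
  degenerate \<open>A = B = 0\<close> falls into the outer cases.\<close>

definition arcs :: "real \<Rightarrow> real \<Rightarrow> real \<Rightarrow> (real \<times> real) list" where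
  "arcs A B K =
    (let r = sqrt (A\<^sup>2 + B\<^sup>2); \<phi> = polar_angle A B; \<alpha> = arccos (K / r) in
     if r < K then []
     else if - r < K then filter nonempty_interval (arc_pieces (\<phi> - \<alpha>) (\<phi> + \<alpha>))
     else [(0, 2 * pi)])"

lemma polar_angle:
  assumes "r = sqrt (A\<^sup>2 + B\<^sup>2)" "0 < r"
  shows "polar_angle A B \<in> {0..2 * pi}" "r * cos (polar_angle A B) = A" "r * sin (polar_angle A B) = B"
proof -
  have r2: "r\<^sup>2 = A\<^sup>2 + B\<^sup>2"
    using assms by simp
  have "\<bar>A\<bar> \<le> r"
    using assms(1) real_sqrt_sum_squares_ge1[of "\<bar>A\<bar>" B] by simp
  then have A: "\<bar>A / r\<bar> \<le> 1" "-1 \<le> A / r" "A / r \<le> 1"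
    using assms(2) by (simp_all add: field_simps abs_le_iff)
  have "(A / r)\<^sup>2 + (B / r)\<^sup>2 = (A\<^sup>2 + B\<^sup>2) / r\<^sup>2"
    by (simp add: power_divide add_divide_distrib)
  also have "\<dots> = 1"
    unfolding r2[symmetric] using assms(2) by simp
  finally have "1 - (A / r)\<^sup>2 = (B / r)\<^sup>2"
    by simp
  \<comment> \<open>The inverse cosine recovers only the absolute value of \<open>B\<close>; the
    reflection in \<open>polar_angle\<close> restores a negative sign.\<close>
  then have sin: "sin (arccos (A / r)) = \<bar>B\<bar> / r"
    using A assms(2) by (simp add: sin_arccos_abs)
  show "polar_angle A B \<in> {0..2 * pi}"
    using arccos_bounded[OF A(2,3)] unfolding polar_angle_def assms(1)[symmetric] Let_def by auto
  show "r * cos (polar_angle A B) = A"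
    using A assms(2) unfolding polar_angle_def assms(1)[symmetric] Let_def
    by (simp add: cos_diff)
  show "r * sin (polar_angle A B) = B"
    using sin assms(2) unfolding polar_angle_def assms(1)[symmetric] Let_def
    by (simp add: sin_diff)
qed

text \<open>Cosine decreases on \<open>[0, pi]\<close>; a larger distance is folded back by
  \<open>2 * pi - \<bar>\<delta>\<bar>\<close>. The range up to \<open>2 * pi\<close> is what
  differences of two angles in \<open>[0, 2 * pi]\<close> require.\<close>

lemma cos_le_cos_iff:
  assumes "0 \<le> \<alpha>" "\<alpha> \<le> pi" "\<bar>\<delta>\<bar> \<le> 2 * pi"
  shows "cos \<alpha> \<le> cos \<delta> \<longleftrightarrow> \<bar>\<delta>\<bar> \<le> \<alpha> \<or> 2 * pi - \<alpha> \<le> \<bar>\<delta>\<bar>"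
proof (cases "\<bar>\<delta>\<bar> \<le> pi")
  case True
  have "cos \<delta> = cos \<bar>\<delta>\<bar>"
    by simp
  then show ?thesis
    using cos_mono_le_eq[of \<alpha> "\<bar>\<delta>\<bar>"] True assms by auto
next
  case False
  have "cos \<delta> = cos (2 * pi - \<bar>\<delta>\<bar>)"
    by (simp add: cos_diff)
  then show ?thesis
    using cos_mono_le_eq[of \<alpha> "2 * pi - \<bar>\<delta>\<bar>"] False assms by auto
qed

text \<open>The two alternatives of \<open>cos_le_cos_iff\<close>, with the second split by the sign
  of \<open>\<theta> - \<phi>\<close>, are exactly the three pieces. Strictness of
  \<open>\<alpha> < pi\<close> separates them, so that the count never exceeds one.\<close>

lemma length_filter_covers_arc_pieces:
  assumes "\<phi> \<in> {0..2 * pi}" "0 \<le> \<alpha>" "\<alpha> < pi" "\<theta> \<in> {0..2 * pi}"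
  shows "length (filter (covers \<theta>) (arc_pieces (\<phi> - \<alpha>) (\<phi> + \<alpha>))) = of_bool (cos \<alpha> \<le> cos (\<theta> - \<phi>))"
proof -
  have "cos \<alpha> \<le> cos (\<theta> - \<phi>) \<longleftrightarrow> \<bar>\<theta> - \<phi>\<bar> \<le> \<alpha> \<or> 2 * pi - \<alpha> \<le> \<bar>\<theta> - \<phi>\<bar>"
    using assms by (intro cos_le_cos_iff) auto
  also have "\<dots> \<longleftrightarrow> (\<phi> - \<alpha> \<le> \<theta> \<and> \<theta> \<le> \<phi> + \<alpha>) \<or> \<theta> \<le> \<phi> + \<alpha> - 2 * pi \<or> \<phi> - \<alpha> + 2 * pi \<le> \<theta>"
    using assms by auto
  finally show ?thesis
    using assms unfolding arc_pieces_def covers_def by auto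
qed

lemma covers_imp_nonempty: "covers \<theta> I \<Longrightarrow> nonempty_interval I"
  unfolding covers_def nonempty_interval_def by linarith

lemma length_filter_covers_arcs:
  assumes \<theta>: "\<theta> \<in> {0..2 * pi}"
  shows "length (filter (covers \<theta>) (arcs A B K)) = of_bool (K \<le> A * cos \<theta> + B * sin \<theta>)"
proof -
  define r where "r = sqrt (A\<^sup>2 + B\<^sup>2)"
  define \<phi> where "\<phi> = polar_angle A B"
  show ?thesis
  proof (cases "0 < r")
    case False
    moreover have "0 \<le> r"
      by (simp add: r_def)
    ultimately have "r = 0"
      by simp
    moreover from this have "A = 0" "B = 0"
      by (auto simp: r_def)
    ultimately show ?thesis
      using \<theta> by (auto simp: arcs_def Let_def covers_def)
  next
    case True
    note p = polar_angle[OF r_def True, folded \<phi>_def]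
    \<comment> \<open>Amplitude and phase form: the constraint becomes a threshold \<open>K\<close>
      on a single shifted cosine of amplitude \<open>r\<close>.\<close>
    have eq: "A * cos \<theta> + B * sin \<theta> = r * cos (\<theta> - \<phi>)"
      using p by (simp add: cos_diff algebra_simps flip: p(2,3))
    have bnd: "r * cos (\<theta> - \<phi>) \<le> r * 1" "r * (- 1) \<le> r * cos (\<theta> - \<phi>)"
      using True by (intro mult_left_mono; simp)+
    consider "r < K" | "K \<le> - r" | "- r < K" "K \<le> r"
      by linarith
    then show ?thesis
    proof cases
      case 3
      define \<alpha> where "\<alpha> = arccos (K / r)"
      have K: "-1 < K / r" "K / r \<le> 1"
        using 3 True by (simp_all add: field_simps)
      then have \<alpha>: "cos \<alpha> = K / r" "0 \<le> \<alpha>" "\<alpha> \<le> pi"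
        using arccos_bounded[of "K / r"] by (simp_all add: \<alpha>_def)
      moreover have "\<alpha> \<noteq> pi"
        using \<alpha>(1) K(1) by auto
      ultimately have "length (filter (covers \<theta>) (arc_pieces (\<phi> - \<alpha>) (\<phi> + \<alpha>))) =
          of_bool (K / r \<le> cos (\<theta> - \<phi>))"
        using length_filter_covers_arc_pieces[of \<phi> \<alpha> \<theta>] \<theta> p(1) by simp
      moreover have "filter (covers \<theta>) (arcs A B K) = filter (covers \<theta>) (arc_pieces (\<phi> - \<alpha>) (\<phi> + \<alpha>))"
        using 3 by (auto simp: arcs_def Let_def simp flip: r_def \<phi>_def \<alpha>_def
            intro!: filter_cong dest: covers_imp_nonempty)
      ultimately show ?thesis
        using True eq by (simp add: field_simps)
    qed (use \<theta> bnd eq in \<open>auto simp: arcs_def Let_def covers_def simp flip: r_def\<close>)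
  qed
qed

lemma arcs_bounds:
  assumes "I \<in> set (arcs A B K)"
  shows "0 \<le> fst I" "fst I \<le> snd I" "snd I \<le> 2 * pi"
proof -
  have pc: "0 \<le> fst I \<and> snd I \<le> 2 * pi" if "\<phi> \<in> {0..2 * pi}" "0 \<le> \<alpha>" "\<alpha> \<le> pi"
    "I \<in> set (arc_pieces (\<phi> - \<alpha>) (\<phi> + \<alpha>))" for \<phi> \<alpha>
    using that unfolding arc_pieces_def by auto
  define r where "r = sqrt (A\<^sup>2 + B\<^sup>2)"
  have "0 \<le> fst I \<and> fst I \<le> snd I \<and> snd I \<le> 2 * pi"
  proof (cases "- r < K \<and> K \<le> r")
    case True
    then have "0 < r"
      by linarith
    then have "-1 \<le> K / r" "K / r \<le> 1"
      using True by (simp_all add: field_simps)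
    then show ?thesis
      using pc[OF polar_angle(1)[OF r_def \<open>0 < r\<close>], of "arccos (K / r)"] arccos_bounded[of "K / r"]
        assms True
      by (auto simp: arcs_def Let_def nonempty_interval_def simp flip: r_def split: if_splits)
  next
    case False
    then show ?thesis
      using assms by (auto simp: arcs_def Let_def simp flip: r_def split: if_splits)
  qed
  then show "0 \<le> fst I" "fst I \<le> snd I" "snd I \<le> 2 * pi"
    by auto
qed

lemma length_arcs: "length (arcs A B K) \<le> 3"
  using length_filter_le[of nonempty_interval "arc_pieces l u" for l u]
  by (auto simp: arcs_def arc_pieces_def Let_def)

section \<open>From the distance test to a threshold on a trigonometric polynomial\<close>

definition feasible_arcs :: "real \<Rightarrow> real^3 \<Rightarrow> (real^3) \<times> (real^3) \<Rightarrow> (real \<times> real) list" where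
  "feasible_arcs \<epsilon> t pq = (let p = fst pq; d = snd pq - t in
     arcs (p$1 * d$1 + p$2 * d$2) (p$2 * d$1 - p$1 * d$2)
       ((p$1 * p$1 + p$2 * p$2 + d$1 * d$1 + d$2 * d$2 + (p$3 - d$3) * (p$3 - d$3) - \<epsilon> * \<epsilon>) / 2))"

text \<open>The rotation preserves the planar length of \<open>p\<close> and its third coordinate,
  so the angle enters the squared distance only through the cross terms. Halving removes their
  factor \<open>2\<close>, and \<open>0 \<le> \<epsilon>\<close> allows squaring.\<close>

lemma norm_rot_le_iff:
  fixes p t q :: "real^3"
  assumes "0 \<le> \<epsilon>" and d: "d = q - t"
  shows "norm (rot \<theta> *v p + t - q) \<le> \<epsilon> \<longleftrightarrow>
    (p$1 * p$1 + p$2 * p$2 + d$1 * d$1 + d$2 * d$2 + (p$3 - d$3) * (p$3 - d$3) - \<epsilon> * \<epsilon>) / 2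
      \<le> (p$1 * d$1 + p$2 * d$2) * cos \<theta> + (p$2 * d$1 - p$1 * d$2) * sin \<theta>"
proof -
  define c s where "c = cos \<theta>" and "s = sin \<theta>"
  have cs: "c * c + s * s = 1"
    using sin_cos_squared_add3[of \<theta>] by (simp add: c_def s_def)
  define v where "v = rot \<theta> *v p + t - q"
  have v: "v$1 = c * p$1 + s * p$2 - d$1" "v$2 = c * p$2 - s * p$1 - d$2" "v$3 = p$3 - d$3"
    by (simp_all add: v_def d c_def s_def rot_def matrix_vector_mult_def sum_3)
  have "v \<bullet> v = v$1 * v$1 + v$2 * v$2 + v$3 * v$3"
    by (simp add: inner_vec_def sum_3)
  \<comment> \<open>Keeping \<open>c * c + s * s\<close> as a factor makes this a polynomial
    identity; the Pythagorean relation is applied only afterwards.\<close>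
  also have "\<dots> = (c * c + s * s) * (p$1 * p$1 + p$2 * p$2) + d$1 * d$1 + d$2 * d$2
      + (p$3 - d$3) * (p$3 - d$3)
      - 2 * ((p$1 * d$1 + p$2 * d$2) * c + (p$2 * d$1 - p$1 * d$2) * s)"
    unfolding v by algebra
  finally have vv: "v \<bullet> v = p$1 * p$1 + p$2 * p$2 + d$1 * d$1 + d$2 * d$2 + (p$3 - d$3) * (p$3 - d$3)
      - 2 * ((p$1 * d$1 + p$2 * d$2) * c + (p$2 * d$1 - p$1 * d$2) * s)"
    by (simp add: cs)
  have "x \<le> e \<longleftrightarrow> (S - e) / 2 \<le> T" if "x = S - 2 * T" for x e S T :: real
    using that by auto
  note half = this[OF vv]
  have "norm v \<le> \<epsilon> \<longleftrightarrow> v \<bullet> v \<le> \<epsilon> * \<epsilon>"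
    using assms(1) by (simp add: norm_le_square power2_eq_square)
  then show ?thesis
    unfolding half unfolding v_def c_def s_def .
qed

lemma length_filter_covers_feasible_arcs:
  assumes "\<theta> \<in> {0..2 * pi}" "0 \<le> \<epsilon>"
  shows "length (filter (covers \<theta>) (feasible_arcs \<epsilon> t pq)) =
    of_bool (norm (rot \<theta> *v fst pq + t - snd pq) \<le> \<epsilon>)"
  unfolding feasible_arcs_def Let_def length_filter_covers_arcs[OF assms(1)]
    norm_rot_le_iff[OF assms(2) refl] ..

definition all_arcs :: "real \<Rightarrow> real^3 \<Rightarrow> ((real^3) \<times> (real^3)) list \<Rightarrow> (real \<times> real) list" where
  "all_arcs \<epsilon> t C = concat (map (feasible_arcs \<epsilon> t) C)"

lemma all_arcs_bounds:
  assumes "I \<in> set (all_arcs \<epsilon> t C)"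
  shows "0 \<le> fst I" "fst I \<le> snd I" "snd I \<le> 2 * pi"
  using assms by (auto simp: all_arcs_def feasible_arcs_def Let_def dest: arcs_bounds)

lemma length_all_arcs: "length (all_arcs \<epsilon> t C) \<le> 3 * length C"
proof (induction C)
  case (Cons pq C)
  have "length (feasible_arcs \<epsilon> t pq) \<le> 3"
    by (simp add: feasible_arcs_def Let_def length_arcs)
  with Cons show ?case
    by (simp add: all_arcs_def)
qed (simp add: all_arcs_def)

lemma votes_eq_length_filter_covers:
  assumes "\<theta> \<in> {0..2 * pi}" "0 \<le> \<epsilon>"
  shows "votes C \<epsilon> t \<theta> = length (filter (covers \<theta>) (all_arcs \<epsilon> t C))"
proof -
  have "votes C \<epsilon> t \<theta> = (\<Sum>pq\<leftarrow>C. of_bool (norm (rot \<theta> *v fst pq + t - snd pq) \<le> \<epsilon>))"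
    by (simp add: votes_def sum_list_sum_nth atLeast0LessThan)
  also have "\<dots> = (\<Sum>pq\<leftarrow>C. length (filter (covers \<theta>) (feasible_arcs \<epsilon> t pq)))"
    using length_filter_covers_feasible_arcs[OF assms] by simp
  also have "\<dots> = length (filter (covers \<theta>) (all_arcs \<epsilon> t C))"
    by (simp add: all_arcs_def filter_concat length_concat comp_def)
  finally show ?thesis .
qed

section \<open>Sweeping sorted endpoints\<close>

text \<open>Per interval: a right end before \<open>\<theta>\<close> forces the left end before it
  too, and the two tests differ exactly when the interval covers \<open>\<theta>\<close>. The
  additive form avoids truncated subtraction.\<close>

lemma length_filter_covers:
  assumes "\<forall>I\<in>set Is. fst I \<le> snd I"
  shows "length (filter (covers \<theta>) Is) + length (filter (\<lambda>x. x < \<theta>) (map snd Is))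
    = length (filter (\<lambda>x. x \<le> \<theta>) (map fst Is))"
  using assms by (induction Is) (auto simp: covers_def)

lemma card_eq_length_filter:
  assumes "mset (map X [0..<m]) = mset xs"
  shows "card {i. i < m \<and> P (X i)} = length (filter P xs)"
proof -
  have "length (filter P xs) = length (filter P (map X [0..<m]))"
    using assms by (metis mset_filter size_mset)
  also have "\<dots> = card {i. i < m \<and> P (X i)}"
    by (simp add: length_filter_conv_card cong: conj_cong)
  finally show ?thesis ..
qed

text \<open>Only the multisets of ends are kept: \<open>L i\<close> and \<open>R i\<close> need not
  belong to the same interval.\<close>

definition sorted_endpoints :: "(real \<times> real) list \<Rightarrow> (nat \<Rightarrow> real) \<Rightarrow> (nat \<Rightarrow> real) \<Rightarrow> bool" where
  "sorted_endpoints Is L R \<longleftrightarrow>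
     (\<forall>I\<in>set Is. fst I \<le> snd I) \<and>
     (\<forall>i j. i \<le> j \<longrightarrow> j < length Is \<longrightarrow> L i \<le> L j) \<and>
     (\<forall>i j. i \<le> j \<longrightarrow> j < length Is \<longrightarrow> R i \<le> R j) \<and>
     mset (map L [0..<length Is]) = mset (map fst Is) \<and>
     mset (map R [0..<length Is]) = mset (map snd Is)"

lemma sorted_endpoints_count:
  assumes "sorted_endpoints Is L R"
  shows "length (filter (covers \<theta>) Is) + card {i. i < length Is \<and> R i < \<theta>}
    = card {i. i < length Is \<and> L i \<le> \<theta>}"
proof -
  have "mset (map L [0..<length Is]) = mset (map fst Is)" "mset (map R [0..<length Is]) = mset (map snd Is)"
    using assms unfolding sorted_endpoints_def by auto
  note eq = card_eq_length_filter[OF this(1), of "\<lambda>x. x \<le> \<theta>"]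
    card_eq_length_filter[OF this(2), of "\<lambda>x. x < \<theta>"]
  have "\<forall>I\<in>set Is. fst I \<le> snd I"
    using assms unfolding sorted_endpoints_def by blast
  then show ?thesis
    unfolding eq by (rule length_filter_covers)
qed

text \<open>Only an inequality, because left endpoints equal to \<open>L j\<close> may follow at
  larger indices and are missed by \<open>Suc j\<close>. A candidate value can thus be too small,
  but it is never more than what \<open>L j\<close> really attains.\<close>

lemma sweep_value_le:
  assumes S: "sorted_endpoints Is L R" and j: "j < length Is"
    and k: "k = card {i. i < length Is \<and> R i < L j}"
  shows "Suc j - k \<le> length (filter (covers (L j)) Is)"
proof -
  have "{..j} \<subseteq> {i. i < length Is \<and> L i \<le> L j}"
    using S j unfolding sorted_endpoints_def by auto
  then have "Suc j \<le> card {i. i < length Is \<and> L i \<le> L j}"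
    using card_mono[of "{i. i < length Is \<and> L i \<le> L j}" "{..j}"] by simp
  then show ?thesis
    using sorted_endpoints_count[OF S, of "L j"] k by linarith
qed

text \<open>The last left endpoint before \<open>\<theta>\<close> does at least as well as \<open>\<theta>\<close>: between the two,
  intervals only end.\<close>

lemma sweep_value_ge:
  assumes S: "sorted_endpoints Is L R" and pos: "length (filter (covers \<theta>) Is) \<noteq> 0"
  shows "\<exists>j<length Is. length (filter (covers \<theta>) Is) \<le> Suc j - card {i. i < length Is \<and> R i < L j}"
proof -
  let ?m = "length Is"
  define A where "A = {i. i < ?m \<and> L i \<le> \<theta>}"
  have fin: "finite A"
    by (simp add: A_def)
  have "A \<noteq> {}"
    using sorted_endpoints_count[OF S, of \<theta>] pos by (auto simp: A_def[symmetric])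
  define j where "j = Max A"
  have j: "j < ?m" "L j \<le> \<theta>"
    using Max_in[OF fin \<open>A \<noteq> {}\<close>] unfolding j_def A_def by auto
  have "A \<subseteq> {..j}"
    using Max_ge[OF fin] by (auto simp: j_def)
  then have "card A \<le> Suc j"
    using card_mono[of "{..j}" A] by simp
  moreover have "card {i. i < ?m \<and> R i < L j} \<le> card {i. i < ?m \<and> R i < \<theta>}"
    using j by (intro card_mono) auto
  ultimately show ?thesis
    using sorted_endpoints_count[OF S, of \<theta>] j(1) unfolding A_def[symmetric] by (intro exI[of _ j]) linarith
qed

section \<open>The program\<close>

definition push_interval :: "name \<Rightarrow> name \<Rightarrow> com" where
  "push_interval x y = IF (BNot (RLess (RVar y) (RVar x)))
     (block [RStore ''L'' (NVar ''m'') (RVar x), RStore ''R'' (NVar ''m'') (RVar y),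
        NAssign ''m'' (NAdd (NVar ''m'') (NConst 1))])
     SKIP"

text \<open>Only integer constants are available, so \<open>pi\<close> is obtained as the inverse
  cosine of \<open>-1\<close>. The constants \<open>0\<close> and \<open>2 * pi\<close> get
  registers because \<open>push_interval\<close> takes register names.\<close>

definition load_constraint :: com where
  "load_constraint = block [
     RAssign ''p1'' (RArr ''p1'' (NVar ''i'')),
     RAssign ''p2'' (RArr ''p2'' (NVar ''i'')),
     RAssign ''d1'' (RSub (RArr ''q1'' (NVar ''i'')) (RVar ''t1'')),
     RAssign ''d2'' (RSub (RArr ''q2'' (NVar ''i'')) (RVar ''t2'')),
     RAssign ''e3'' (RSub (RArr ''p3'' (NVar ''i'')) (RSub (RArr ''q3'' (NVar ''i'')) (RVar ''t3''))),
     RAssign ''A'' (RAdd (RMul (RVar ''p1'') (RVar ''d1'')) (RMul (RVar ''p2'') (RVar ''d2''))),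
     RAssign ''B'' (RSub (RMul (RVar ''p2'') (RVar ''d1'')) (RMul (RVar ''p1'') (RVar ''d2''))),
     RAssign ''K'' (RDiv
       (RSub (RAdd (RAdd (RAdd (RAdd (RMul (RVar ''p1'') (RVar ''p1''))
         (RMul (RVar ''p2'') (RVar ''p2''))) (RMul (RVar ''d1'') (RVar ''d1'')))
         (RMul (RVar ''d2'') (RVar ''d2''))) (RMul (RVar ''e3'') (RVar ''e3'')))
         (RMul (RVar ''eps'') (RVar ''eps'')))
       (RConst 2)),
     RAssign ''r'' (RSqrt (RAdd (RMul (RVar ''A'') (RVar ''A'')) (RMul (RVar ''B'') (RVar ''B'')))),
     RAssign ''zero'' (RConst 0),
     RAssign ''twopi'' (RMul (RConst 2) (RArccos (RConst (- 1))))]"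

definition compute_angles :: com where
  "compute_angles = block [
     RAssign ''alpha'' (RArccos (RDiv (RVar ''K'') (RVar ''r''))),
     RAssign ''phi'' (RArccos (RDiv (RVar ''A'') (RVar ''r''))),
     IF (RLess (RVar ''B'') (RVar ''zero''))
       (RAssign ''phi'' (RSub (RVar ''twopi'') (RVar ''phi''))) SKIP]"

definition compute_ends :: com where
  "compute_ends = block [
     RAssign ''l'' (RSub (RVar ''phi'') (RVar ''alpha'')),
     RAssign ''u'' (RAdd (RVar ''phi'') (RVar ''alpha'')),
     RAssign ''u2'' (RSub (RVar ''u'') (RVar ''twopi'')),
     RAssign ''l3'' (RAdd (RVar ''l'') (RVar ''twopi''))]"

text \<open>Has to run after \<open>compute_ends\<close>, since the translated ends
  \<open>u2\<close> and \<open>l3\<close> are derived from the unclamped \<open>l\<close> and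
  \<open>u\<close>.\<close>

definition clamp_ends :: com where
  "clamp_ends = SEQ
     (IF (RLess (RVar ''l'') (RVar ''zero'')) (RAssign ''l'' (RVar ''zero'')) SKIP)
     (IF (RLess (RVar ''twopi'') (RVar ''u'')) (RAssign ''u'' (RVar ''twopi'')) SKIP)"

definition compute_arc :: com where
  "compute_arc = block [compute_angles, compute_ends, clamp_ends]"

definition push_arc_pieces :: com where
  "push_arc_pieces = block [compute_arc,
     push_interval ''l'' ''u'', push_interval ''zero'' ''u2'', push_interval ''l3'' ''twopi'']"

definition push_arcs :: com where
  "push_arcs = IF (RLess (RVar ''r'') (RVar ''K'')) SKIP
     (IF (RLess (RSub (RVar ''zero'') (RVar ''r'')) (RVar ''K'')) push_arc_pieces
       (push_interval ''zero'' ''twopi''))"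

definition collect_step :: com where
  "collect_step = block [load_constraint, push_arcs, NAssign ''i'' (NAdd (NVar ''i'') (NConst 1))]"

definition collect :: com where
  "collect = WHILE (NLess (NVar ''i'') (NVar ''M'')) collect_step"

text \<open>The initial pair \<open>U = 0\<close>, \<open>theta = 0\<close> is already a valid lower
  bound and is the answer if no interval is stored. Register \<open>k\<close> must be reset because
  sorting has used it.\<close>

definition sweep_init :: com where
  "sweep_init = block [NAssign ''j'' (NConst 0), NAssign ''k'' (NConst 0), NAssign ''U'' (NConst 0),
     RAssign ''theta'' (RConst 0)]"

text \<open>Each execution advances exactly one of \<open>j\<close> and \<open>k\<close>, and
  \<open>k\<close> never moves back because the left endpoints increase. This bounds the loop by
  \<open>2 * m\<close> iterations.\<close>

definition sweep_step :: com where
  "sweep_step = IF (BAnd (NLess (NVar ''k'') (NVar ''m''))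
       (RLess (RArr ''R'' (NVar ''k'')) (RArr ''L'' (NVar ''j''))))
     (NAssign ''k'' (NAdd (NVar ''k'') (NConst 1)))
     (SEQ (IF (NLess (NVar ''U'') (NSub (NAdd (NVar ''j'') (NConst 1)) (NVar ''k'')))
          (SEQ (NAssign ''U'' (NSub (NAdd (NVar ''j'') (NConst 1)) (NVar ''k'')))
            (RAssign ''theta'' (RArr ''L'' (NVar ''j''))))
          SKIP)
       (NAssign ''j'' (NAdd (NVar ''j'') (NConst 1))))"

definition sweep :: com where
  "sweep = SEQ sweep_init (WHILE (NLess (NVar ''j'') (NVar ''m'')) sweep_step)"

definition max_votes_program :: com where
  "max_votes_program = SEQ collect (SEQ (merge_sort ''L'') (SEQ (merge_sort ''R'') sweep))"

section \<open>Correctness of the collecting loop\<close>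

definition stores_intervals :: "state \<Rightarrow> (real \<times> real) list \<Rightarrow> bool" where
  "stores_intervals s Is \<longleftrightarrow> nvar s ''m'' = length Is \<and>
     (\<forall>j<length Is. rarr s ''L'' j = fst (Is ! j) \<and> rarr s ''R'' j = snd (Is ! j))"

lemma stores_intervals_push_interval:
  assumes "stores_intervals s Is"
  shows "stores_intervals (step (push_interval x y) s)
    (Is @ filter nonempty_interval [(rvar s x, rvar s y)])"
  using assms unfolding stores_intervals_def
  by (auto simp: push_interval_def nonempty_interval_def nth_append less_Suc_eq)

lemma while_free_push_interval [simp]: "while_free (push_interval x y)"
  by (simp add: push_interval_def)

lemma rvar_push_interval [simp]: "rvar (step (push_interval x y) s) = rvar s"
  by (simp add: push_interval_def)

lemma compute_angles_correct:
  assumes "rvar s ''r'' = sqrt ((rvar s ''A'')\<^sup>2 + (rvar s ''B'')\<^sup>2)"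
    and "rvar s ''zero'' = 0" "rvar s ''twopi'' = 2 * pi"
  defines "s' \<equiv> step compute_angles s"
  shows "rvar s' ''phi'' = polar_angle (rvar s ''A'') (rvar s ''B'')"
    and "rvar s' ''alpha'' = arccos (rvar s ''K'' / rvar s ''r'')"
proof -
  have "polar_angle (rvar s ''A'') (rvar s ''B'') =
      (if rvar s ''B'' < 0 then 2 * pi - arccos (rvar s ''A'' / rvar s ''r'')
       else arccos (rvar s ''A'' / rvar s ''r''))"
    by (simp add: polar_angle_def Let_def assms(1))
  then show "rvar s' ''phi'' = polar_angle (rvar s ''A'') (rvar s ''B'')"
    and "rvar s' ''alpha'' = arccos (rvar s ''K'' / rvar s ''r'')"
    using assms(2,3) by (simp_all add: s'_def compute_angles_def)
qed

lemma compute_ends_correct: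
  fixes s defines "s' \<equiv> step compute_ends s"
  shows "rvar s' ''l'' = rvar s ''phi'' - rvar s ''alpha''" "rvar s' ''u'' = rvar s ''phi'' + rvar s ''alpha''"
    "rvar s' ''u2'' = rvar s ''phi'' + rvar s ''alpha'' - rvar s ''twopi''"
    "rvar s' ''l3'' = rvar s ''phi'' - rvar s ''alpha'' + rvar s ''twopi''"
  unfolding s'_def compute_ends_def by simp_all

lemma clamp_ends_correct:
  fixes s defines "s' \<equiv> step clamp_ends s"
  shows "rvar s' ''l'' = max (rvar s ''zero'') (rvar s ''l'')" "rvar s' ''u'' = min (rvar s ''twopi'') (rvar s ''u'')"
  unfolding s'_def clamp_ends_def by simp_all

lemma compute_arc_correct:
  assumes r: "rvar s ''r'' = sqrt ((rvar s ''A'')\<^sup>2 + (rvar s ''B'')\<^sup>2)"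
    and c: "rvar s ''zero'' = 0" "rvar s ''twopi'' = 2 * pi"
    and \<phi>: "\<phi> = polar_angle (rvar s ''A'') (rvar s ''B'')"
    and \<alpha>: "\<alpha> = arccos (rvar s ''K'' / rvar s ''r'')"
  defines "s' \<equiv> step compute_arc s"
  shows "arc_pieces (\<phi> - \<alpha>) (\<phi> + \<alpha>) =
      [(rvar s' ''l'', rvar s' ''u''), (rvar s' ''zero'', rvar s' ''u2''), (rvar s' ''l3'', rvar s' ''twopi'')]"
    and "nvar s' = nvar s" "rarr s' = rarr s"
proof -
  define s1 where "s1 = step compute_angles s"
  define s2 where "s2 = step compute_ends s1"
  have s': "s' = step clamp_ends s2"
    by (simp add: s'_def compute_arc_def s1_def s2_def)
  have wf: "while_free compute_angles" "while_free compute_ends" "while_free clamp_ends"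
    by (simp_all add: compute_angles_def compute_ends_def clamp_ends_def)
  have [simp]: "nvars_written compute_angles = {}" "nvars_written compute_ends = {}" "nvars_written clamp_ends = {}"
    "rarrs_written compute_angles = {}" "rarrs_written compute_ends = {}" "rarrs_written clamp_ends = {}"
    "rvars_written compute_angles = {''alpha'', ''phi''}"
    "rvars_written compute_ends = {''l'', ''u'', ''u2'', ''l3''}" "rvars_written clamp_ends = {''l'', ''u''}"
    by (auto simp: compute_angles_def compute_ends_def clamp_ends_def)
  show "nvar s' = nvar s" "rarr s' = rarr s"
    unfolding s' s2_def s1_def by (rule ext, simp add: step_frame wf)+
  have angles: "rvar s1 ''phi'' = \<phi>" "rvar s1 ''alpha'' = \<alpha>" "rvar s1 ''zero'' = 0" "rvar s1 ''twopi'' = 2 * pi"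
    using compute_angles_correct[OF r c] c by (simp_all add: s1_def \<phi> \<alpha> step_frame wf)
  have ends: "rvar s2 ''l'' = \<phi> - \<alpha>" "rvar s2 ''u'' = \<phi> + \<alpha>" "rvar s2 ''u2'' = \<phi> + \<alpha> - 2 * pi"
    "rvar s2 ''l3'' = \<phi> - \<alpha> + 2 * pi" "rvar s2 ''zero'' = 0" "rvar s2 ''twopi'' = 2 * pi"
    using compute_ends_correct[of s1] by (simp_all add: s2_def angles step_frame wf)
  have "rvar s' ''l'' = max 0 (\<phi> - \<alpha>)" "rvar s' ''u'' = min (2 * pi) (\<phi> + \<alpha>)"
    "rvar s' ''u2'' = \<phi> + \<alpha> - 2 * pi" "rvar s' ''l3'' = \<phi> - \<alpha> + 2 * pi"
    "rvar s' ''zero'' = 0" "rvar s' ''twopi'' = 2 * pi"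
    using clamp_ends_correct[of s2] by (simp_all add: s' ends step_frame wf)
  then show "arc_pieces (\<phi> - \<alpha>) (\<phi> + \<alpha>) =
      [(rvar s' ''l'', rvar s' ''u''), (rvar s' ''zero'', rvar s' ''u2''), (rvar s' ''l3'', rvar s' ''twopi'')]"
    by (simp add: arc_pieces_def)
qed

lemma stores_intervals_push_arcs:
  assumes s: "stores_intervals s Is"
    and r: "rvar s ''r'' = sqrt ((rvar s ''A'')\<^sup>2 + (rvar s ''B'')\<^sup>2)"
    and c: "rvar s ''zero'' = 0" "rvar s ''twopi'' = 2 * pi"
  shows "stores_intervals (step push_arcs s) (Is @ arcs (rvar s ''A'') (rvar s ''B'') (rvar s ''K''))"
proof -
  have "stores_intervals (step push_arc_pieces s) (Is @ filter nonempty_interval (arc_pieces (\<phi> - \<alpha>) (\<phi> + \<alpha>)))"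
    if \<phi>: "\<phi> = polar_angle (rvar s ''A'') (rvar s ''B'')"
      and \<alpha>: "\<alpha> = arccos (rvar s ''K'' / rvar s ''r'')" for \<phi> \<alpha>
  proof -
    define s1 where "s1 = step compute_arc s"
    define s2 where "s2 = step (push_interval ''l'' ''u'') s1"
    define s3 where "s3 = step (push_interval ''zero'' ''u2'') s2"
    note C = compute_arc_correct[OF r c \<phi> \<alpha>, folded s1_def]
    have "stores_intervals s1 Is"
      using s C(2,3) by (simp add: stores_intervals_def)
    from stores_intervals_push_interval[OF this, of "''l''" "''u''", folded s2_def]
    have "stores_intervals s2 (Is @ filter nonempty_interval [(rvar s1 ''l'', rvar s1 ''u'')])" .
    from stores_intervals_push_interval[OF this, of "''zero''" "''u2''", folded s3_def]
    have "stores_intervals s3 ((Is @ filter nonempty_interval [(rvar s1 ''l'', rvar s1 ''u'')])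
       @ filter nonempty_interval [(rvar s1 ''zero'', rvar s1 ''u2'')])"
      by (simp add: s2_def)
    note pushed = stores_intervals_push_interval[OF this, of "''l3''" "''twopi''"]
    have rvar: "rvar s3 = rvar s1"
      by (simp add: s3_def s2_def)
    have split: "filter nonempty_interval [a, b, c] =
        filter nonempty_interval [a] @ filter nonempty_interval [b] @ filter nonempty_interval [c]"
      for a b c
      by simp
    have step: "step push_arc_pieces s = step (push_interval ''l3'' ''twopi'') s3"
      by (simp add: push_arc_pieces_def s1_def s2_def s3_def)
    show ?thesis
      using pushed unfolding C(1) split step rvar append_assoc .
  qed
  note pieces = this[OF refl refl]
  show ?thesis
  proof (cases "rvar s ''r'' < rvar s ''K''")
    case True
    then show ?thesis
      using s by (simp add: push_arcs_def arcs_def r Let_def)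
  next
    case False
    show ?thesis
    proof (cases "- rvar s ''r'' < rvar s ''K''")
      case True
      then have "step push_arcs s = step push_arc_pieces s"
        using False c by (simp add: push_arcs_def)
      moreover have "arcs (rvar s ''A'') (rvar s ''B'') (rvar s ''K'') =
        (let \<phi> = polar_angle (rvar s ''A'') (rvar s ''B''); \<alpha> = arccos (rvar s ''K'' / rvar s ''r'') in
          filter nonempty_interval (arc_pieces (\<phi> - \<alpha>) (\<phi> + \<alpha>)))"
        using True False unfolding arcs_def r[symmetric] by (simp add: Let_def)
      ultimately show ?thesis
        using pieces by (simp add: Let_def)
    next
      case 2: False
      then have "step push_arcs s = step (push_interval ''zero'' ''twopi'') s"
        using False c by (simp add: push_arcs_def)
      moreover have "arcs (rvar s ''A'') (rvar s ''B'') (rvar s ''K'') =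
          filter nonempty_interval [(rvar s ''zero'', rvar s ''twopi'')]"
        using 2 False c unfolding arcs_def r[symmetric] by (simp add: Let_def nonempty_interval_def)
      ultimately show ?thesis
        using stores_intervals_push_interval[OF s] by metis
    qed
  qed
qed

lemma load_constraint_correct:
  assumes "rvar s ''eps'' = \<epsilon>" "rvar s ''t1'' = t$1" "rvar s ''t2'' = t$2" "rvar s ''t3'' = t$3"
    and "rarr s ''p1'' i = fst pq $ 1" "rarr s ''p2'' i = fst pq $ 2" "rarr s ''p3'' i = fst pq $ 3"
    and "rarr s ''q1'' i = snd pq $ 1" "rarr s ''q2'' i = snd pq $ 2" "rarr s ''q3'' i = snd pq $ 3"
    and "nvar s ''i'' = i"
  defines "s' \<equiv> step load_constraint s"
  shows "arcs (rvar s' ''A'') (rvar s' ''B'') (rvar s' ''K'') = feasible_arcs \<epsilon> t pq"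
    and "rvar s' ''r'' = sqrt ((rvar s' ''A'')\<^sup>2 + (rvar s' ''B'')\<^sup>2)"
    and "rvar s' ''zero'' = 0" "rvar s' ''twopi'' = 2 * pi"
    and "nvar s' = nvar s" "rarr s' = rarr s"
  using assms(1-11) unfolding s'_def feasible_arcs_def Let_def
  by (simp_all add: load_constraint_def power2_eq_square)

lemma collect_correct:
  "terminates collect (input_state C \<epsilon> t) (400 * (length C + 1))
    (\<lambda>s. stores_intervals s (all_arcs \<epsilon> t C))"
proof -
  let ?s = "input_state C \<epsilon> t" and ?M = "length C" and ?b = "NLess (NVar ''i'') (NVar ''M'')"
  define input_kept where "input_kept s \<longleftrightarrow> nvar s ''M'' = ?M \<and>
    (\<forall>x\<in>{''eps'', ''t1'', ''t2'', ''t3''}. rvar s x = rvar ?s x) \<and>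
    (\<forall>a\<in>{''p1'', ''p2'', ''p3'', ''q1'', ''q2'', ''q3''}. rarr s a = rarr ?s a)" for s :: state
  define I where "I j s \<longleftrightarrow> input_kept s \<and> nvar s ''i'' \<le> ?M \<and> j = ?M - nvar s ''i'' \<and>
    stores_intervals s (all_arcs \<epsilon> t (take (nvar s ''i'') C))" for j and s :: state
  have lf: "while_free load_constraint" "while_free push_arcs"
    by (simp_all add: load_constraint_def push_arcs_def push_arc_pieces_def compute_arc_def
        compute_angles_def compute_ends_def clamp_ends_def)
  have written: "nvars_written load_constraint = {}" "rarrs_written load_constraint = {}"
    "rvars_written load_constraint =
       {''p1'', ''p2'', ''d1'', ''d2'', ''e3'', ''A'', ''B'', ''K'', ''r'', ''zero'', ''twopi''}"
    "nvars_written push_arcs = {''m''}" "rarrs_written push_arcs = {''L'', ''R''}"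
    "rvars_written push_arcs = {''alpha'', ''phi'', ''l'', ''u'', ''u2'', ''l3''}"
    by (auto simp: load_constraint_def push_arcs_def push_arc_pieces_def compute_arc_def
        compute_angles_def compute_ends_def clamp_ends_def push_interval_def)
  have body: "0 < j \<and> terminates collect_step s 390 (I (j - 1))"
    if I: "I j s" and b: "bval ?b s" for j s
  proof -
    define i where "i = nvar s ''i''"
    have i: "i < ?M" "0 < j"
      using I b by (auto simp: I_def i_def input_kept_def)
    have kept: "input_kept s"
      using I by (simp add: I_def)
    define s1 where "s1 = step load_constraint s"
    define s2 where "s2 = step push_arcs s1"
    have L: "arcs (rvar s1 ''A'') (rvar s1 ''B'') (rvar s1 ''K'') = feasible_arcs \<epsilon> t (C ! i)"
      "rvar s1 ''r'' = sqrt ((rvar s1 ''A'')\<^sup>2 + (rvar s1 ''B'')\<^sup>2)"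
      "rvar s1 ''zero'' = 0" "rvar s1 ''twopi'' = 2 * pi" "nvar s1 = nvar s" "rarr s1 = rarr s"
      using kept i(1) unfolding s1_def
      by (intro load_constraint_correct[where i = i];
          simp add: input_kept_def input_state_def input_array_def i_def case_prod_beta)+
    have "stores_intervals s1 (all_arcs \<epsilon> t (take i C))"
      using I L(5,6) by (simp add: I_def stores_intervals_def i_def)
    from stores_intervals_push_arcs[OF this L(2-4), folded s2_def]
    have "stores_intervals s2 (all_arcs \<epsilon> t (take (Suc i) C))"
      using i(1) L(1) by (simp add: take_Suc_conv_app_nth all_arcs_def)
    moreover have "input_kept s2" "nvar s2 ''i'' = i"
      using kept by (simp_all add: s2_def s1_def input_kept_def i_def step_frame lf written)
    moreover have "step collect_step s = s2\<lparr>nvar := (nvar s2)(''i'' := Suc (nvar s2 ''i''))\<rparr>"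
      by (simp add: collect_step_def s2_def s1_def)
    ultimately have "I (j - 1) (step collect_step s)"
      using i I by (simp add: I_def input_kept_def stores_intervals_def i_def)
    moreover have "while_free collect_step" "time_bound collect_step \<le> 390"
      by (simp_all add: collect_step_def load_constraint_def push_arcs_def push_arc_pieces_def
          compute_arc_def compute_angles_def compute_ends_def clamp_ends_def push_interval_def)
    ultimately show ?thesis
      using i(2) by (simp add: terminates_step)
  qed
  \<comment> \<open>No initialisation code is needed: memory outside the input is zero, so
    \<open>i\<close> and \<open>m\<close> start at \<open>0\<close>.\<close>
  have init: "I ?M ?s"
    by (simp add: I_def input_kept_def input_state_def all_arcs_def stores_intervals_def)
  have "terminates collect ?s ((?M + 1) * (1 + bcost ?b + 390)) (\<lambda>s. (\<exists>j. I j s) \<and> \<not> bval ?b s)"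
    unfolding collect_def by (rule terminates_While[OF body init])
  then show ?thesis
    by (rule terminates_mono) (auto simp: I_def input_kept_def)
qed

lemma sweep_correct:
  assumes S: "sorted_endpoints Is (rarr s ''L'') (rarr s ''R'')" and m: "nvar s ''m'' = length Is"
    and range: "\<forall>I\<in>set Is. fst I \<in> {0..2 * pi}"
  shows "terminates sweep s (60 * (2 * length Is + 1)) (\<lambda>s'.
    (\<forall>\<theta>. length (filter (covers \<theta>) Is) \<le> nvar s' ''U'') \<and>
    nvar s' ''U'' \<le> length (filter (covers (rvar s' ''theta'')) Is) \<and>
    rvar s' ''theta'' \<in> {0..2 * pi})"
proof -
  let ?m = "length Is" and ?b = "NLess (NVar ''j'') (NVar ''m'')"
  define L R where "L = rarr s ''L''" and "R = rarr s ''R''"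
  note S = S[folded L_def R_def]
  define val where "val j = Suc j - card {i. i < ?m \<and> R i < L j}" for j
  \<comment> \<open>The counter is the total distance of both pointers from \<open>m\<close>. The
    conjunct on right ends is guarded by \<open>j < m\<close>, since no left endpoint is stored at
    index \<open>m\<close>.\<close>
  define I where "I n s' \<longleftrightarrow> nvar s' ''m'' = ?m \<and> rarr s' ''L'' = L \<and> rarr s' ''R'' = R \<and>
    nvar s' ''j'' \<le> ?m \<and> nvar s' ''k'' \<le> ?m \<and> n = (?m - nvar s' ''j'') + (?m - nvar s' ''k'') \<and>
    (nvar s' ''j'' < ?m \<longrightarrow> (\<forall>i<nvar s' ''k''. R i < L (nvar s' ''j''))) \<and>
    (\<forall>i<nvar s' ''j''. val i \<le> nvar s' ''U'') \<and>
    nvar s' ''U'' \<le> length (filter (covers (rvar s' ''theta'')) Is) \<and>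
    rvar s' ''theta'' \<in> {0..2 * pi}" for n and s' :: state
  have L_range: "L j \<in> {0..2 * pi}" if "j < ?m" for j
  proof -
    have "set (map L [0..<?m]) = set (map fst Is)"
      using S unfolding sorted_endpoints_def by (metis set_mset_mset)
    moreover have "L j \<in> set (map L [0..<?m])"
      using that by simp
    ultimately show ?thesis
      using range by auto
  qed
  have body: "0 < n \<and> terminates sweep_step s' 40 (I (n - 1))" if I: "I n s'" and b: "bval ?b s'" for n s'
  proof -
    define j k where "j = nvar s' ''j''" and "k = nvar s' ''k''"
    have j: "j < ?m" and k: "k \<le> ?m" and n: "n = (?m - j) + (?m - k)"
      and R_less: "\<And>i. i < k \<Longrightarrow> R i < L j"
      using I b by (auto simp: I_def j_def k_def)
    have "I (n - 1) (step sweep_step s')"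
    proof (cases "k < ?m \<and> R k < L j")
      case True
      then have "step sweep_step s' = s'\<lparr>nvar := (nvar s')(''k'' := Suc k)\<rparr>"
        using I by (simp add: I_def sweep_step_def j_def k_def)
      then show ?thesis
        using I True n by (auto simp: I_def j_def k_def less_Suc_eq)
    next
      case False
      \<comment> \<open>When the advance test fails, either \<open>k = m\<close> or
        \<open>R k\<close> is not left of \<open>L j\<close>; by sortedness of \<open>R\<close>
        nothing from \<open>k\<close> on is, so \<open>k\<close> is the required count.\<close>
      have "{i. i < ?m \<and> R i < L j} = {..<k}"
      proof (intro set_eqI iffI)
        fix i assume i: "i \<in> {i. i < ?m \<and> R i < L j}"
        show "i \<in> {..<k}"
        proof (rule ccontr)
          assume "i \<notin> {..<k}"
          then have "R k \<le> R i" "k < ?m"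
            using S i unfolding sorted_endpoints_def by auto
          then show False
            using False i by auto
        qed
      qed (use R_less k in auto)
      then have k_eq: "k = card {i. i < ?m \<and> R i < L j}"
        by simp
      then have val: "val j = Suc j - k"
        by (simp add: val_def)
      have le: "val j \<le> length (filter (covers (L j)) Is)"
        using sweep_value_le[OF S j k_eq] val by simp
      have mono: "\<forall>i<k. R i < L (Suc j)" if "Suc j < ?m"
      proof -
        have "L j \<le> L (Suc j)"
          using S that unfolding sorted_endpoints_def by auto
        then show ?thesis
          using R_less by force
      qed
      have step: "step sweep_step s' =
        (if nvar s' ''U'' < val j
         then s'\<lparr>nvar := (nvar s')(''U'' := val j, ''j'' := Suc j), rvar := (rvar s')(''theta'' := L j)\<rparr>
         else s'\<lparr>nvar := (nvar s')(''j'' := Suc j)\<rparr>)"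
        using I False val by (auto simp: I_def sweep_step_def j_def k_def)
      show ?thesis
      proof (cases "nvar s' ''U'' < val j")
        case True
        with step show ?thesis
          using I j n le mono L_range[OF j] by (force simp: I_def j_def k_def less_Suc_eq)
      next
        case False
        with step show ?thesis
          using I j n mono by (auto simp: I_def j_def k_def less_Suc_eq)
      qed
    qed
    moreover have "while_free sweep_step" "time_bound sweep_step \<le> 40"
      by (simp_all add: sweep_step_def)
    ultimately show ?thesis
      using j n by (simp add: terminates_step)
  qed
  have init: "terminates sweep_init s 10 (I (2 * ?m))"
    by (rule terminates_step) (auto simp: sweep_init_def I_def L_def R_def m)
  have "terminates sweep s (10 + (2 * ?m + 1) * (1 + bcost ?b + 40)) (\<lambda>s'. (\<exists>n. I n s') \<and> \<not> bval ?b s')"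
    unfolding sweep_def by (rule terminates_Seq[OF init]) (rule terminates_While[OF body])
  then show ?thesis
  proof (rule terminates_mono)
    fix s' assume "(\<exists>n. I n s') \<and> \<not> bval ?b s'"
    then have le: "\<forall>i<?m. val i \<le> nvar s' ''U''"
      and U: "nvar s' ''U'' \<le> length (filter (covers (rvar s' ''theta'')) Is)"
        "rvar s' ''theta'' \<in> {0..2 * pi}"
      by (auto simp: I_def)
    have "length (filter (covers \<theta>) Is) \<le> nvar s' ''U''" for \<theta>
    proof (cases "length (filter (covers \<theta>) Is) = 0")
      case False
      from sweep_value_ge[OF S this] obtain j where "j < ?m" "length (filter (covers \<theta>) Is) \<le> val j"
        unfolding val_def by blast
      with le show ?thesis
        using order_trans by blast
    qed simp
    with U show "(\<forall>\<theta>. length (filter (covers \<theta>) Is) \<le> nvar s' ''U'') \<and>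
        nvar s' ''U'' \<le> length (filter (covers (rvar s' ''theta'')) Is) \<and>
        rvar s' ''theta'' \<in> {0..2 * pi}"
      by blast
  qed simp
qed

text \<open>At most \<open>3 * M\<close> intervals are sorted; the rounded logarithm bounds the
  passes, and the \<open>+ 1\<close> inside keeps it nonnegative for \<open>M = 0\<close>. Per
  correspondence, collecting costs 400, the two sorts \<open>2 * 150 * 3\<close> per pass, and the
  sweep \<open>60 * 2 * 3\<close>, together below 2000.\<close>

definition running_time :: "nat \<Rightarrow> nat" where
  "running_time M = 2000 * (M + 1) * (nat \<lceil>log 2 (3 * real M + 1)\<rceil> + 1)"

text \<open>The ceiling costs at most one, so it is first absorbed into a smooth majorant, whose
  growth is then compared automatically. That \<open>M * ln M\<close> vanishes at small
  \<open>M\<close> does not matter for an eventual bound.\<close>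

lemma running_time_bigo: "(\<lambda>M. real (running_time M)) \<in> O(\<lambda>M. real M * ln (real M))"
proof (rule landau_o.big.trans)
  show "(\<lambda>M. real (running_time M)) \<in> O(\<lambda>M. 2000 * (real M + 1) * (log 2 (3 * real M + 1) + 2))"
  proof (intro bigoI[of _ 1] always_eventually allI)
    fix M
    have "0 \<le> log 2 (3 * real M + 1)"
      by simp
    then have "real (nat \<lceil>log 2 (3 * real M + 1)\<rceil>) \<le> log 2 (3 * real M + 1) + 1"
      by linarith
    then have le: "real (nat \<lceil>log 2 (3 * real M + 1)\<rceil>) + 1 \<le> log 2 (3 * real M + 1) + 2"
      by linarith
    have "real (running_time M) = 2000 * (real M + 1) * (real (nat \<lceil>log 2 (3 * real M + 1)\<rceil>) + 1)"
      by (simp only: running_time_def of_nat_mult of_nat_add of_nat_1 of_nat_numeral)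
    also have "\<dots> \<le> 2000 * (real M + 1) * (log 2 (3 * real M + 1) + 2)"
      using le by (rule mult_left_mono) simp
    finally show "norm (real (running_time M)) \<le> 1 * norm (2000 * (real M + 1) * (log 2 (3 * real M + 1) + 2))"
      by simp
  qed
  show "(\<lambda>M. 2000 * (real M + 1) * (log 2 (3 * real M + 1) + 2)) \<in> O(\<lambda>M. real M * ln (real M))"
    by real_asymp
qed

lemma max_votes_program_correct:
  assumes "0 < \<epsilon>"
  shows "terminates max_votes_program (input_state C \<epsilon> t) (running_time (length C)) (\<lambda>s.
    nvar s ''U'' = max_votes C \<epsilon> t \<and> rvar s ''theta'' \<in> {0..2 * pi} \<and>
    votes C \<epsilon> t (rvar s ''theta'') = max_votes C \<epsilon> t)"
proof -
  let ?M = "length C" and ?Is = "all_arcs \<epsilon> t C"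
  let ?m = "length ?Is"
  define P where "P = nat \<lceil>log 2 (3 * real ?M + 1)\<rceil>"
  have m: "?m \<le> 3 * ?M"
    by (rule length_all_arcs)
  have "log 2 (3 * real ?M + 1) \<le> real P"
    by (simp add: P_def)
  then have "3 * real ?M + 1 \<le> 2 powr real P"
    by (subst (asm) log_le_iff) auto
  then have "real (3 * ?M + 1) \<le> real (2 ^ P)"
    by (simp only: powr_realpow zero_less_numeral of_nat_add of_nat_mult of_nat_power of_nat_numeral of_nat_1)
  then have "3 * ?M + 1 \<le> 2 ^ P"
    by (simp only: of_nat_le_iff)
  then have mP: "?m \<le> 2 ^ P"
    using m by linarith
  have written: "nvars_written (merge_sort x) = {''w'', ''k'', ''a'', ''mid'', ''b'', ''hi''}"
    "rarrs_written (merge_sort x) = {x, ''tmp''}" for x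
    by (auto simp: merge_sort_def merge_pass_def merge_step_def refill_def select_next_def copy_back_def)
  have "fst I \<le> snd I \<and> fst I \<in> {0..2 * pi}" if "I \<in> set ?Is" for I
    using all_arcs_bounds[OF that] by simp
  then have bounds: "\<forall>I\<in>set ?Is. fst I \<le> snd I" "\<forall>I\<in>set ?Is. fst I \<in> {0..2 * pi}"
    by blast+
  let ?sorted = "\<lambda>X f. (\<forall>i j. i \<le> j \<longrightarrow> j < ?m \<longrightarrow> X i \<le> (X j :: real)) \<and>
    mset (map X [0..<?m]) = mset (map f ?Is)"
  have sortL: "terminates (merge_sort ''L'') s (150 * (P + 1) * (?m + 1))
      (\<lambda>s'. nvar s' ''m'' = ?m \<and> map (rarr s' ''R'') [0..<?m] = map snd ?Is \<and> ?sorted (rarr s' ''L'') fst)"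
    if s: "stores_intervals s ?Is" for s
  proof -
    have L: "map (rarr s ''L'') [0..<?m] = map fst ?Is" "map (rarr s ''R'') [0..<?m] = map snd ?Is"
      using s by (auto simp: stores_intervals_def intro!: nth_equalityI)
    have ms: "nvar s ''m'' = ?m"
      using s by (simp add: stores_intervals_def)
    have "terminates (merge_sort ''L'') s (150 * (P + 1) * (nvar s ''m'' + 1)) (\<lambda>s'.
      (\<forall>i j. i \<le> j \<longrightarrow> j < nvar s ''m'' \<longrightarrow> rarr s' ''L'' i \<le> rarr s' ''L'' j) \<and>
      mset (map (rarr s' ''L'') [0..<nvar s ''m'']) = mset (map (rarr s ''L'') [0..<nvar s ''m'']))"
      using mP ms by (intro merge_sort_correct) auto
    from terminates_frame[OF this] show ?thesis
      by (rule terminates_mono) (use ms L in \<open>simp_all add: written del: map_eq_conv mset_map\<close>)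
  qed
  have sortR: "terminates (merge_sort ''R'') s (150 * (P + 1) * (?m + 1))
      (\<lambda>s'. nvar s' ''m'' = ?m \<and> sorted_endpoints ?Is (rarr s' ''L'') (rarr s' ''R''))"
    if s: "nvar s ''m'' = ?m \<and> map (rarr s ''R'') [0..<?m] = map snd ?Is \<and> ?sorted (rarr s ''L'') fst" for s
  proof -
    have ms: "nvar s ''m'' = ?m"
      using s by simp
    have "terminates (merge_sort ''R'') s (150 * (P + 1) * (nvar s ''m'' + 1)) (\<lambda>s'.
      (\<forall>i j. i \<le> j \<longrightarrow> j < nvar s ''m'' \<longrightarrow> rarr s' ''R'' i \<le> rarr s' ''R'' j) \<and>
      mset (map (rarr s' ''R'') [0..<nvar s ''m'']) = mset (map (rarr s ''R'') [0..<nvar s ''m'']))"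
      using mP ms by (intro merge_sort_correct) auto
    from terminates_frame[OF this] show ?thesis
      by (rule terminates_mono)
        (use s bounds(1) in \<open>simp_all add: written sorted_endpoints_def del: map_eq_conv mset_map\<close>)
  qed
  have final: "terminates sweep s (60 * (2 * ?m + 1)) (\<lambda>s'.
      nvar s' ''U'' = max_votes C \<epsilon> t \<and> rvar s' ''theta'' \<in> {0..2 * pi} \<and>
      votes C \<epsilon> t (rvar s' ''theta'') = max_votes C \<epsilon> t)"
    if s: "nvar s ''m'' = ?m \<and> sorted_endpoints ?Is (rarr s ''L'') (rarr s ''R'')" for s
  proof -
    have "terminates sweep s (60 * (2 * ?m + 1)) (\<lambda>s'.
      (\<forall>\<theta>. length (filter (covers \<theta>) ?Is) \<le> nvar s' ''U'') \<and>
      nvar s' ''U'' \<le> length (filter (covers (rvar s' ''theta'')) ?Is) \<and>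
      rvar s' ''theta'' \<in> {0..2 * pi})"
      using s bounds(2) by (intro sweep_correct) auto
    then show ?thesis
    proof (rule terminates_mono[OF _ order_refl])
      fix s' assume *: "(\<forall>\<theta>. length (filter (covers \<theta>) ?Is) \<le> nvar s' ''U'') \<and>
        nvar s' ''U'' \<le> length (filter (covers (rvar s' ''theta'')) ?Is) \<and>
        rvar s' ''theta'' \<in> {0..2 * pi}"
      note votes = votes_eq_length_filter_covers[OF _ less_imp_le[OF assms], of _ C t]
      obtain \<theta> where \<theta>: "\<theta> \<in> {0..2 * pi}" "max_votes C \<epsilon> t = votes C \<epsilon> t \<theta>"
        using max_votes_is_maximum(1)[of C \<epsilon> t] by blast
      \<comment> \<open>The sweep bounds all counts by \<open>U\<close> and \<open>U\<close> by the
        count at \<open>theta\<close>. The three inequalities close the cycle from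
        \<open>max_votes\<close> through \<open>U\<close> and the votes at \<open>theta\<close> back
        to \<open>max_votes\<close>.\<close>
      then have "max_votes C \<epsilon> t \<le> nvar s' ''U''"
        using * votes by simp
      moreover have "nvar s' ''U'' \<le> votes C \<epsilon> t (rvar s' ''theta'')"
        using * votes by simp
      moreover have "votes C \<epsilon> t (rvar s' ''theta'') \<le> max_votes C \<epsilon> t"
        using * max_votes_is_maximum(2) by blast
      ultimately show "nvar s' ''U'' = max_votes C \<epsilon> t \<and> rvar s' ''theta'' \<in> {0..2 * pi} \<and>
          votes C \<epsilon> t (rvar s' ''theta'') = max_votes C \<epsilon> t"
        using * by simp
    qed
  qed
  have "terminates max_votes_program (input_state C \<epsilon> t)
      (400 * (?M + 1) + (150 * (P + 1) * (?m + 1) + (150 * (P + 1) * (?m + 1) + 60 * (2 * ?m + 1))))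
      (\<lambda>s. nvar s ''U'' = max_votes C \<epsilon> t \<and> rvar s ''theta'' \<in> {0..2 * pi} \<and>
        votes C \<epsilon> t (rvar s ''theta'') = max_votes C \<epsilon> t)"
    unfolding max_votes_program_def
    using collect_correct sortL sortR final by (intro terminates_Seq)
  then show ?thesis
  proof (rule terminates_mono)
    have "150 * (P + 1) * (?m + 1) \<le> 150 * (P + 1) * (3 * ?M + 1)"
      using m by (intro mult_left_mono) auto
    moreover have "60 * (2 * ?m + 1) \<le> 360 * ?M + 60"
      using m by simp
    ultimately have "400 * (?M + 1) + (150 * (P + 1) * (?m + 1) + (150 * (P + 1) * (?m + 1) + 60 * (2 * ?m + 1)))
      \<le> 400 * (?M + 1) + (300 * (P + 1) * (3 * ?M + 1) + (360 * ?M + 60))"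
      by linarith
    also have "\<dots> \<le> 2000 * (?M + 1) * (P + 1)"
      by (simp add: algebra_simps)
    finally show "400 * (?M + 1) + (150 * (P + 1) * (?m + 1) + (150 * (P + 1) * (?m + 1) + 60 * (2 * ?m + 1)))
      \<le> running_time ?M"
      by (simp only: running_time_def P_def)
  qed
qed

theorem mainTheorem5:
  "\<exists>(P :: com) (T :: nat \<Rightarrow> nat).
     (\<lambda>M. real (T M)) \<in> O(\<lambda>M. real M * ln (real M)) \<and>
     (\<forall>(C :: ((real^3) \<times> (real^3)) list) (\<epsilon> :: real) (t :: real^3). \<epsilon> > 0 \<longrightarrow>
        (\<exists>n s. exec P (input_state C \<epsilon> t) n s \<and>
           n \<le> T (length C) \<and>
           nvar s ''U'' = max_votes C \<epsilon> t \<and>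
           rvar s ''theta'' \<in> {0..2*pi} \<and>
           votes C \<epsilon> t (rvar s ''theta'') = max_votes C \<epsilon> t))"
  using running_time_bigo max_votes_program_correct unfolding terminates_def by blast

end
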